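(* Let $(X_{n,j})_{n,j\in\mathbb{N}}$ be a family of independent random variables, each uniformly distributed on $[0,1)$. Let $\alpha>1$ and $\beta>1$ satisfy $(\zeta(\alpha)-1)(\zeta(\beta)-1)<1$, where $\zeta$ is the Riemann zeta function. Let $B=178$ and let $A_s$ ($s\in\mathbb{N}$) be the constants defined in the context. Then $$\mathbb{P}\left(D_N^{*s}(\mathcal{P}_{N,s})\le \sqrt{\alpha A_s+\beta B\,\frac{\ln(\log_2 N)}{s}}\,\sqrt{\frac{s}{N}}\ \text{ for all } s\in\mathbb{N} \text{ and all } N\ge 2\right)>1-(\zeta(\alpha)-1)(\zeta(\beta)-1).$$ Moreover, $A_2\le 942$.
   Context: For $s,N\in\mathbb{N}$, $\mathcal{P}_{N,s}$ denotes the finite sequence of $N$ points $X^{(n)}_s=(X_{n,1},\dots,X_{n,s})\in[0,1)^s$, $n=1,\dots,N$ (the upper-left $N\times s$ block of the matrix, rows read as points). For points $x_1,\dots,x_N\in[0,1)^s$, the star-discrepancy is $$D_N^{*s}(x_1,\dots,x_N)=\sup_{y\in[0,1]^s}\left|\frac1N\sum_{k=1}^N \mathbf{1}_{[0,y)}(x_k)-\lambda([0,y))\right|,$$ where $[0,y)=\{z\in[0,1)^s: 0\le z<y\}$ (componentwise) and $\lambda$ is $s$-dimensional Lebesgue measure. Define $b_{-1}=b_0=3$ and $b_k=2^{-k+3}(1-2^{-k})$ for $k\ge1$. Let $C_s=\max\{1,1.1^{s-101}\}$. For $k\ge0$ set $$a_{k,s}=b_k\left(\frac{\ln\!\left(C_s\,2^{k+2}\sqrt{2/\pi}\right)}{s}+\ln\!\left(2e(2^{k+1}+1)\right)\right),$$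 and $a_{-1,s}=a_{0,s}$. Put $A_s=2\left(\sum_{k=-1}^{\infty}\sqrt{a_{k,s}}\right)^2$. *)

theory Defs
  imports "HOL-Probability.Probability"
begin

definition zeta_real :: "real \<Rightarrow> real" where
  "zeta_real a = (\<Sum>n. 1 / (real (Suc n)) powr a)"

definition star_discrepancy :: "nat \<Rightarrow> nat \<Rightarrow> (nat \<Rightarrow> nat \<Rightarrow> real) \<Rightarrow> real" where
  "star_discrepancy s N x =
     (SUP y \<in> (PiE {1..s} (\<lambda>_. {0..1::real})).
        \<bar>real (card {k \<in> {1..N}. \<forall>i\<in>{1..s}. 0 \<le> x k i \<and> x k i < y i}) / real N
         - (\<Prod>i\<in>{1..s}. y i)\<bar>)"

text \<open>b_k for k \<ge> 0 (b_{-1} = b_0 = 3).\<close>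
definition b_coef :: "nat \<Rightarrow> real" where
  "b_coef k = (if k = 0 then 3 else 2 powr (3 - real k) * (1 - 2 powr (- real k)))"

definition C_const :: "nat \<Rightarrow> real" where
  "C_const s = max 1 (1.1 powr (real s - 101))"

text \<open>a_{k,s} for k \<ge> 0; a_{-1,s} = a_{0,s}.\<close>
definition a_coef :: "nat \<Rightarrow> nat \<Rightarrow> real" where
  "a_coef s k = b_coef k * (ln (C_const s * 2 ^ (k + 2) * sqrt (2 / pi)) / real s
                             + ln (2 * exp 1 * (2 ^ (k + 1) + 1)))"

text \<open>A_s = 2 (sum_{k=-1}^\<infinity> sqrt a_{k,s})^2, the k = -1 term being sqrt a_{0,s}.\<close>
definition A_const :: "nat \<Rightarrow> real" where
  "A_const s = 2 * (sqrt (a_coef s 0) + (\<Sum>k. sqrt (a_coef s k)))\<^sup>2"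

end

theory Submission
  imports Defs
begin

text \<open>
  Fix \<open>s\<close> and a dyadic block \<open>2 ^ m \<le> N < 2 ^ (m + 1)\<close>. With \<open>S\<close> the sum whose square is
  \<open>A_s / 2\<close> and \<open>\<tau>\<^sup>2 = 2 \<alpha> s + 178 \<beta> ln m / S\<^sup>2\<close>, the claimed bound on
  \<open>N * D_N\<close> is at least \<open>S \<tau> sqrt (2 ^ m)\<close>. If this exceeds the trivial bound there is nothing
  to prove; this disposes of \<open>m = 1\<close> for every \<open>s\<close>.

  Otherwise every box is approximated by a chain of boxes from bracketing covers with precision
  \<open>2 ^ (- k)\<close>, \<open>k \<le> K\<close>, where \<open>K\<close> is just large enough for the final error
  \<open>N / 2 ^ K\<close> to be absorbed by the term with index -1 of the sum \<open>S\<close>. The counting error of a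
  link at level \<open>k\<close> is a centred Bernoulli sum of variance at most \<open>b_k / 8\<close> per summand, and
  it must stay below \<open>sqrt a_k \<tau> sqrt (2 ^ m)\<close>. A maximal Bernstein inequality over all
  \<open>N < 2 ^ (m + 1)\<close> bounds the failure probability of a link by
  \<open>2 exp (- L_k \<tau>\<^sup>2)\<close>, where \<open>a_k = b_k L_k\<close>, and \<open>S\<^sup>2 \<le> 178 L_k\<close> turns this into at
  most \<open>2 exp (- 2 \<alpha> s L_k) m ^ (- \<beta>)\<close>. Since \<open>exp (2 s L_k)\<close> dominates the number of links, the
  block fails with probability at most \<open>(s + 1) ^ (- \<alpha>) m ^ (- \<beta>) / 2\<close>, and the sum
  over \<open>s \<ge> 1\<close> and \<open>m \<ge> 2\<close> is half of the product of the two zeta terms.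
\<close>

section \<open>A maximal Bernstein inequality\<close>

text \<open>Defined on real sequences rather than on random variables, so that dependence on the
  first \<open>j\<close> factors alone is visible; this yields independence from factor
  \<open>j\<close>.\<close>

primrec stopped_prod :: "real \<Rightarrow> (nat \<Rightarrow> real) \<Rightarrow> nat \<Rightarrow> real" where
  "stopped_prod c w 0 = 1"
| "stopped_prod c w (Suc j) =
     (if c \<le> stopped_prod c w j then stopped_prod c w j else stopped_prod c w j * w j)"

lemma stopped_prod_cong:
  "(\<And>i. i < j \<Longrightarrow> w i = w' i) \<Longrightarrow> stopped_prod c w j = stopped_prod c w' j"
  by (induction j) auto

lemma stopped_prod_nonneg:
  "(\<And>i. i < j \<Longrightarrow> 0 \<le> w i) \<Longrightarrow> 0 \<le> stopped_prod c w j"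
  by (induction j) auto

lemma stopped_prod_le_power:
  assumes "1 \<le> D" "\<And>i. i < j \<Longrightarrow> 0 \<le> w i" "\<And>i. i < j \<Longrightarrow> w i \<le> D"
  shows "stopped_prod c w j \<le> D ^ j"
  using assms
proof (induction j)
  case (Suc j)
  have nn: "0 \<le> stopped_prod c w j" using Suc.prems by (intro stopped_prod_nonneg) auto
  have le: "stopped_prod c w j \<le> D ^ j" using Suc by auto
  have "stopped_prod c w j * 1 \<le> D ^ j * D"
    using le nn Suc.prems by (intro mult_mono) auto
  moreover have "stopped_prod c w j * w j \<le> D ^ j * D"
    using le nn Suc.prems by (intro mult_mono) auto
  ultimately show ?case by (auto simp: mult.commute)
qed simp

lemma stopped_prod_ge:
  assumes "j \<le> n" "c \<le> (\<Prod>i<j. w i)"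
  shows "c \<le> stopped_prod c w n"
proof -
  have stay: "c \<le> stopped_prod c w (j + d)" if "c \<le> stopped_prod c w j" for j d
    using that by (induction d) auto
  have "(\<exists>i\<le>j. c \<le> stopped_prod c w i) \<or> stopped_prod c w j = (\<Prod>i<j. w i)" for j
    by (induction j) (auto simp: le_Suc_eq mult.commute)
  from this[of j] obtain i where "i \<le> j" "c \<le> stopped_prod c w i"
    using assms by (metis order_refl)
  with stay[of i "n - i"] assms show ?thesis by simp
qed

lemma stopped_prod_measurable:
  "{..<j} \<subseteq> I \<Longrightarrow> (\<lambda>w. stopped_prod c w j) \<in> borel_measurable (PiM I (\<lambda>_. borel))"
proof (induction j)
  case (Suc j)
  then have [measurable]: "(\<lambda>w. stopped_prod c w j) \<in> borel_measurable (PiM I (\<lambda>_. borel))"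
    by (metis lessThan_subset_iff lessI less_imp_le order_trans)
  have [measurable]: "(\<lambda>w. w j) \<in> borel_measurable (PiM I (\<lambda>_. borel))"
    using Suc.prems by (intro measurable_component_singleton) auto
  show ?case by simp
qed simp

text \<open>The product, frozen once it reaches \<open>c\<close>, is a supermartingale; Markov's inequality applies
  to its terminal value.\<close>

lemma (in prob_space) prob_partial_prod_ge_le:
  fixes W :: "nat \<Rightarrow> 'a \<Rightarrow> real"
  assumes ind: "indep_vars (\<lambda>_. borel) W {..<n}"
    and nn: "\<And>i \<omega>. i < n \<Longrightarrow> \<omega> \<in> space M \<Longrightarrow> 0 \<le> W i \<omega>"
    and bd: "\<And>i \<omega>. i < n \<Longrightarrow> \<omega> \<in> space M \<Longrightarrow> W i \<omega> \<le> D"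
    and ex: "\<And>i. i < n \<Longrightarrow> expectation (W i) \<le> 1"
    and c: "0 < c"
  shows "prob {\<omega> \<in> space M. \<exists>j\<le>n. c \<le> (\<Prod>i<j. W i \<omega>)} \<le> 1 / c"
proof -
  define T where "T j \<omega> = stopped_prod c (\<lambda>i. W i \<omega>) j" for j \<omega>
  \<comment> \<open>A path frozen early has fewer than \<open>j\<close> factors, so a bound
    \<open>D' ^ j\<close> requires a base of at least 1.\<close>
  define D' where "D' = max 1 D"
  have Wm: "random_variable borel (W i)" if "i < n" for i
    using ind that by (auto simp: indep_vars_def)
  have Wint: "integrable M (W i)" if "i < n" for i
    using Wm[OF that] nn[OF that] bd[OF that]
    by (intro integrable_const_bound[where B=D]) auto
  have Tdec: "T j = (\<lambda>w. stopped_prod c w j) \<circ> (\<lambda>\<omega>. restrict (\<lambda>i. W i \<omega>) {..<j})" for j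
    unfolding T_def comp_def by (intro ext stopped_prod_cong) auto
  have resm: "(\<lambda>\<omega>. restrict (\<lambda>i. W i \<omega>) {..<j}) \<in> measurable M (PiM {..<j} (\<lambda>_. borel))"
    if "j \<le> n" for j
    using that Wm by (intro measurable_restrict) auto
  have Tm: "random_variable borel (T j)" if "j \<le> n" for j
    unfolding Tdec by (rule measurable_comp[OF resm[OF that] stopped_prod_measurable]) auto
  have Tnn: "0 \<le> T j \<omega>" if "j \<le> n" "\<omega> \<in> space M" for j \<omega>
    unfolding T_def using nn that by (intro stopped_prod_nonneg) auto
  have Tbd: "T j \<omega> \<le> D' ^ j" if "j \<le> n" "\<omega> \<in> space M" for j \<omega>
    unfolding T_def using nn bd that by (intro stopped_prod_le_power) (auto simp: D'_def le_max_iff_disj)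
  have Tint: "integrable M (T j)" if "j \<le> n" for j
    using Tm[OF that] Tnn[OF that] Tbd[OF that]
    by (intro integrable_const_bound[where B="D' ^ j"]) auto
  have "expectation (T j) \<le> 1" if "j \<le> n" for j
    using that
  proof (induction j)
    case 0
    then show ?case by (simp add: T_def prob_space)
  next
    case (Suc j)
    \<comment> \<open>\<open>R\<close> is \<open>T j\<close> on paths still running and 0 on frozen
      ones. Hence \<open>T (Suc j)\<close> is \<open>(T j - R) + R * W j\<close>, and the
      expectation of the last product factorises.\<close>
    define g where "g x = (if c \<le> x then 0 else x)" for x :: real
    define R where "R \<omega> = g (T j \<omega>)" for \<omega>
    have gm [measurable]: "g \<in> borel_measurable borel" unfolding g_def by measurable
    have "indep_var borel ((\<lambda>w. g (stopped_prod c w j)) \<circ> (\<lambda>\<omega>. restrict (\<lambda>i. W i \<omega>) {..<j}))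
            borel ((\<lambda>w. w j) \<circ> (\<lambda>\<omega>. restrict (\<lambda>i. W i \<omega>) {j}))"
      using Suc.prems stopped_prod_measurable[of j "{..<j}" c]
      by (intro indep_var_compose[OF indep_var_restrict[OF ind]]) auto
    moreover have "(\<lambda>w. g (stopped_prod c w j)) \<circ> (\<lambda>\<omega>. restrict (\<lambda>i. W i \<omega>) {..<j}) = R"
      unfolding R_def Tdec by (simp add: comp_def)
    moreover have "(\<lambda>w. w j) \<circ> (\<lambda>\<omega>. restrict (\<lambda>i. W i \<omega>) {j}) = W j" by auto
    ultimately have iv: "indep_var borel R borel (W j)" by simp
    have j: "j \<le> n" "j < n" using Suc.prems by auto
    have Rm: "random_variable borel R" unfolding R_def using Tm[OF j(1)] by measurable
    have Rnn: "0 \<le> R \<omega>" and RT: "R \<omega> \<le> T j \<omega>" if "\<omega> \<in> space M" for \<omega>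
      using Tnn[OF j(1) that] by (auto simp: R_def g_def)
    have Rint: "integrable M R"
      using Rm Rnn RT Tbd[OF j(1)]
      by (intro integrable_const_bound[where B="D' ^ j"]) (auto intro!: AE_I2 intro: order_trans[OF RT])
    have RWint: "integrable M (\<lambda>\<omega>. R \<omega> * W j \<omega>)"
      by (rule indep_var_integrable[OF iv Rint Wint[OF j(2)]])
    have "expectation (T (Suc j)) = expectation (\<lambda>\<omega>. (T j \<omega> - R \<omega>) + R \<omega> * W j \<omega>)"
      by (rule Bochner_Integration.integral_cong) (auto simp: T_def R_def g_def)
    also have "\<dots> = expectation (T j) - expectation R + expectation (\<lambda>\<omega>. R \<omega> * W j \<omega>)"
      using Tint[OF j(1)] Rint RWint by simp
    also have "expectation (\<lambda>\<omega>. R \<omega> * W j \<omega>) = expectation R * expectation (W j)"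
      by (rule indep_var_lebesgue_integral[OF iv Rint Wint[OF j(2)]])
    also have "\<dots> \<le> expectation R * 1"
      using ex[OF j(2)] Rnn by (intro mult_left_mono integral_nonneg_AE) auto
    finally show ?case using Suc by simp
  qed
  then have ET: "expectation (T n) \<le> 1" by simp
  have "prob {\<omega> \<in> space M. \<exists>j\<le>n. c \<le> (\<Prod>i<j. W i \<omega>)} \<le> prob {\<omega> \<in> space M. c \<le> T n \<omega>}"
    using Tm[of n] unfolding T_def by (intro finite_measure_mono) (auto intro: stopped_prod_ge)
  also have "\<dots> \<le> expectation (T n) / c"
    using Tint[of n] Tnn[of n] c by (intro integral_Markov_inequality_measure[where A="{}"]) auto
  also have "\<dots> \<le> 1 / c" using ET c by (simp add: divide_right_mono)
  finally show ?thesis .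
qed

text \<open>For negative \<open>x\<close>, the right side minus the left has derivative at most
  \<open>t \<le> 0\<close> on \<open>[x, 0]\<close>, because \<open>exp t \<ge> 1 + t\<close>, and
  it vanishes at 0.\<close>

lemma exp_le_quadratic:
  fixes x :: real
  assumes "x \<le> 1"
  shows "exp x \<le> 1 + x + x\<^sup>2"
proof (cases "0 \<le> x")
  case True
  then show ?thesis using assms exp_bound[of x] by simp
next
  case False
  define f where "f t = 1 + t + t\<^sup>2 - exp t" for t :: real
  have "f 0 \<le> f x"
  proof (rule DERIV_nonpos_imp_nonincreasing[of x 0])
    fix t :: real assume "x \<le> t" "t \<le> 0"
    have "(f has_real_derivative (1 + 2 * t - exp t)) (at t)"
      unfolding f_def by (auto intro!: derivative_eq_intros)
    moreover have "1 + 2 * t - exp t \<le> 0"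
      using exp_ge_add_one_self[of t] \<open>t \<le> 0\<close> by linarith
    ultimately show "\<exists>y. (f has_real_derivative y) (at t) \<and> y \<le> 0" by blast
  qed (use False in auto)
  then show ?thesis by (simp add: f_def)
qed

text \<open>The exponent is at most 1, so the quadratic bound on \<open>exp\<close> applies
  pointwise; the linear term has mean 0 and the quadratic term is governed by the variance.\<close>

lemma (in prob_space) bernoulli_mgf_le:
  fixes Y :: "'a \<Rightarrow> real"
  assumes Y: "random_variable borel Y" and Y01: "\<And>\<omega>. \<omega> \<in> space M \<Longrightarrow> Y \<omega> \<in> {0, 1}"
    and p: "expectation Y = p" and \<theta>: "\<bar>\<theta>\<bar> \<le> 1"
  shows "expectation (\<lambda>\<omega>. exp (\<theta> * (Y \<omega> - p))) \<le> exp (\<theta>\<^sup>2 * (p * (1 - p)))"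
proof -
  have Yint: "integrable M Y"
    using Y Y01 by (intro integrable_const_bound[where B=1]) force+
  have "0 \<le> p" "p \<le> 1"
  proof -
    have "0 \<le> expectation Y" using Y01 by (intro integral_nonneg_AE) force
    moreover have "expectation Y \<le> expectation (\<lambda>_. 1)"
      using Y01 Yint by (intro integral_mono) force+
    ultimately show "0 \<le> p" "p \<le> 1" using p by (auto simp: prob_space)
  qed
  \<comment> \<open>\<open>Y\<^sup>2 = Y\<close> for 0-1 values makes the square affine in
    \<open>Y\<close>.\<close>
  have sq: "(Y \<omega> - p)\<^sup>2 = (1 - 2 * p) * Y \<omega> + p\<^sup>2" if "\<omega> \<in> space M" for \<omega>
    using Y01[OF that] by (auto simp: power2_eq_square algebra_simps)
  have bnd: "\<theta> * (Y \<omega> - p) \<le> 1" if "\<omega> \<in> space M" for \<omega>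
  proof -
    have "\<bar>Y \<omega> - p\<bar> \<le> 1" using Y01[OF that] \<open>0 \<le> p\<close> \<open>p \<le> 1\<close> by auto
    then have "\<bar>\<theta>\<bar> * \<bar>Y \<omega> - p\<bar> \<le> 1 * 1" using \<theta> by (intro mult_mono) auto
    then show ?thesis by (simp add: abs_mult[symmetric])
  qed
  have int: "integrable M (\<lambda>\<omega>. exp (\<theta> * (Y \<omega> - p)))"
    using Y bnd by (intro integrable_const_bound[where B="exp 1"]) auto
  have "expectation (\<lambda>\<omega>. exp (\<theta> * (Y \<omega> - p)))
      \<le> expectation (\<lambda>\<omega>. 1 + \<theta> * (Y \<omega> - p) + \<theta>\<^sup>2 * ((1 - 2 * p) * Y \<omega> + p\<^sup>2))"
  proof (rule integral_mono[OF int])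
    show "integrable M (\<lambda>\<omega>. 1 + \<theta> * (Y \<omega> - p) + \<theta>\<^sup>2 * ((1 - 2 * p) * Y \<omega> + p\<^sup>2))"
      using Yint by simp
    fix \<omega> assume "\<omega> \<in> space M"
    then show "exp (\<theta> * (Y \<omega> - p)) \<le> 1 + \<theta> * (Y \<omega> - p) + \<theta>\<^sup>2 * ((1 - 2 * p) * Y \<omega> + p\<^sup>2)"
      using exp_le_quadratic[OF bnd] by (simp add: sq[symmetric] power_mult_distrib)
  qed
  also have "\<dots> = 1 + \<theta>\<^sup>2 * (p * (1 - p))"
    using Yint p by (simp add: prob_space) (simp add: algebra_simps power2_eq_square)
  also have "\<dots> \<le> exp (\<theta>\<^sup>2 * (p * (1 - p)))" by (rule exp_ge_add_one_self)
  finally show ?thesis .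
qed

lemma (in prob_space) bernoulli_maximal_bernstein_aux:
  fixes Y :: "nat \<Rightarrow> 'a \<Rightarrow> real"
  assumes ind: "indep_vars (\<lambda>_. borel) Y {..<n}"
    and Y01: "\<And>i \<omega>. i < n \<Longrightarrow> \<omega> \<in> space M \<Longrightarrow> Y i \<omega> \<in> {0, 1}"
    and ex: "\<And>i. i < n \<Longrightarrow> expectation (Y i) = p"
    and v: "p * (1 - p) \<le> v" "0 \<le> v" and \<theta>: "\<bar>\<theta>\<bar> \<le> 1"
  shows "prob {\<omega> \<in> space M. \<exists>j\<le>n. u \<le> \<theta> * (\<Sum>i<j. Y i \<omega> - p)} \<le> exp (n * v * \<theta>\<^sup>2 - u)"
proof -
  define W where "W i \<omega> = exp (\<theta> * (Y i \<omega> - p) - v * \<theta>\<^sup>2)" for i \<omega>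
  have Ym: "random_variable borel (Y i)" if "i < n" for i
    using ind that by (auto simp: indep_vars_def)
  have prodW: "(\<Prod>i<j. W i \<omega>) = exp (\<theta> * (\<Sum>i<j. Y i \<omega> - p) - j * v * \<theta>\<^sup>2)" for j \<omega>
    unfolding W_def by (simp add: exp_sum[symmetric] sum_subtractf sum_distrib_left algebra_simps)
  have indW: "indep_vars (\<lambda>_. borel) W {..<n}"
    unfolding W_def by (rule indep_vars_compose2[OF ind]) auto
  have "prob {\<omega> \<in> space M. \<exists>j\<le>n. exp (u - n * v * \<theta>\<^sup>2) \<le> (\<Prod>i<j. W i \<omega>)} \<le> 1 / exp (u - n * v * \<theta>\<^sup>2)"
  proof (rule prob_partial_prod_ge_le[OF indW, where D="exp (\<bar>\<theta>\<bar> * (1 + \<bar>p\<bar>))"])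
    fix i \<omega> assume i: "i < n" and \<omega>: "\<omega> \<in> space M"
    have "\<theta> * (Y i \<omega> - p) \<le> \<bar>\<theta>\<bar> * \<bar>Y i \<omega> - p\<bar>" by (metis abs_ge_self abs_mult)
    also have "\<dots> \<le> \<bar>\<theta>\<bar> * (1 + \<bar>p\<bar>)" using Y01[OF i \<omega>] by (intro mult_left_mono) auto
    finally show "W i \<omega> \<le> exp (\<bar>\<theta>\<bar> * (1 + \<bar>p\<bar>))"
      using v by (simp add: W_def) (smt (verit) mult_nonneg_nonneg zero_le_power2)
  next
    fix i assume i: "i < n"
    have "expectation (W i) = expectation (\<lambda>\<omega>. exp (\<theta> * (Y i \<omega> - p))) * exp (- v * \<theta>\<^sup>2)"
      unfolding W_def diff_conv_add_uminus[of "_ * _" "v * \<theta>\<^sup>2"] exp_add by simp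
    also have "\<dots> \<le> exp (\<theta>\<^sup>2 * (p * (1 - p))) * exp (- v * \<theta>\<^sup>2)"
      using i by (intro mult_right_mono bernoulli_mgf_le Ym Y01 ex \<theta>) auto
    also have "\<dots> = exp (\<theta>\<^sup>2 * (p * (1 - p) - v))" by (simp add: exp_add[symmetric] algebra_simps)
    also have "\<dots> \<le> 1" using v by (simp add: mult_nonneg_nonpos)
    finally show "expectation (W i) \<le> 1" .
  qed (auto simp: W_def)
  also have "1 / exp (u - n * v * \<theta>\<^sup>2) = exp (n * v * \<theta>\<^sup>2 - u)" by (simp add: exp_diff)
  finally have *: "prob {\<omega> \<in> space M. \<exists>j\<le>n. exp (u - n * v * \<theta>\<^sup>2) \<le> (\<Prod>i<j. W i \<omega>)}
      \<le> exp (n * v * \<theta>\<^sup>2 - u)" .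
  have Wm: "random_variable borel (W i)" if "i < n" for i
    using indW that by (auto simp: indep_vars_def)
  have "prob {\<omega> \<in> space M. \<exists>j\<le>n. u \<le> \<theta> * (\<Sum>i<j. Y i \<omega> - p)}
      \<le> prob {\<omega> \<in> space M. \<exists>j\<le>n. exp (u - n * v * \<theta>\<^sup>2) \<le> (\<Prod>i<j. W i \<omega>)}"
  proof (rule finite_measure_mono)
    show "{\<omega> \<in> space M. \<exists>j\<le>n. exp (u - n * v * \<theta>\<^sup>2) \<le> (\<Prod>i<j. W i \<omega>)} \<in> events"
    proof -
      have "{\<omega> \<in> space M. exp (u - n * v * \<theta>\<^sup>2) \<le> (\<Prod>i<j. W i \<omega>)} \<in> events" if "j \<le> n" for j
        using that Wm by (intro borel_measurable_le borel_measurable_prod) auto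
      then have "(\<Union>j\<in>{..n}. {\<omega> \<in> space M. exp (u - n * v * \<theta>\<^sup>2) \<le> (\<Prod>i<j. W i \<omega>)}) \<in> events"
        by (intro sets.finite_UN) auto
      also have "(\<Union>j\<in>{..n}. {\<omega> \<in> space M. exp (u - n * v * \<theta>\<^sup>2) \<le> (\<Prod>i<j. W i \<omega>)})
          = {\<omega> \<in> space M. \<exists>j\<le>n. exp (u - n * v * \<theta>\<^sup>2) \<le> (\<Prod>i<j. W i \<omega>)}" by auto
      finally show ?thesis .
    qed
    have "j * v * \<theta>\<^sup>2 \<le> n * v * \<theta>\<^sup>2" if "j \<le> n" for j
      using that v by (intro mult_right_mono) auto
    then show "{\<omega> \<in> space M. \<exists>j\<le>n. u \<le> \<theta> * (\<Sum>i<j. Y i \<omega> - p)}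
        \<subseteq> {\<omega> \<in> space M. \<exists>j\<le>n. exp (u - n * v * \<theta>\<^sup>2) \<le> (\<Prod>i<j. W i \<omega>)}"
      unfolding prodW by force
  qed
  with * show ?thesis by simp
qed

lemma (in prob_space) bernoulli_maximal_bernstein:
  fixes Y :: "nat \<Rightarrow> 'a \<Rightarrow> real"
  assumes ind: "indep_vars (\<lambda>_. borel) Y {..<n}"
    and Y01: "\<And>i \<omega>. i < n \<Longrightarrow> \<omega> \<in> space M \<Longrightarrow> Y i \<omega> \<in> {0, 1}"
    and ex: "\<And>i. i < n \<Longrightarrow> expectation (Y i) = p"
    and v: "p * (1 - p) \<le> v" "0 < v" and n: "0 < n"
    and t: "0 \<le> t" "t \<le> 2 * n * v"
  shows "prob {\<omega> \<in> space M. \<exists>j\<le>n. t < \<bar>\<Sum>i<j. Y i \<omega> - p\<bar>} \<le> 2 * exp (- (t\<^sup>2 / (4 * n * v)))"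
proof -
  \<comment> \<open>This \<open>\<theta>\<close> minimises
    \<open>n * v * \<theta>\<^sup>2 - \<theta> * t\<close>; the hypothesis
    \<open>t \<le> 2 * n * v\<close> says exactly that it is at most 1.\<close>
  define \<theta> where "\<theta> = t / (2 * n * v)"
  have nv: "0 < n * v" using n v by simp
  have \<theta>: "0 \<le> \<theta>" "\<theta> \<le> 1" using t nv by (auto simp: \<theta>_def field_simps)
  have Ym: "random_variable borel (Y i)" if "i < n" for i
    using ind that by (auto simp: indep_vars_def)
  have val: "n * v * \<theta>\<^sup>2 - \<theta> * t = - (t\<^sup>2 / (4 * n * v))"
    using nv by (simp add: \<theta>_def field_simps power2_eq_square)
  have ev: "{\<omega> \<in> space M. \<exists>j\<le>n. \<theta> * t \<le> \<eta> * (\<Sum>i<j. Y i \<omega> - p)} \<in> events" for \<eta>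
  proof -
    have "{\<omega> \<in> space M. \<theta> * t \<le> \<eta> * (\<Sum>i<j. Y i \<omega> - p)} \<in> events" if "j \<le> n" for j
      using that Ym by (intro borel_measurable_le borel_measurable_times borel_measurable_sum borel_measurable_diff) auto
    then have "(\<Union>j\<in>{..n}. {\<omega> \<in> space M. \<theta> * t \<le> \<eta> * (\<Sum>i<j. Y i \<omega> - p)}) \<in> events"
      by (intro sets.finite_UN) auto
    also have "(\<Union>j\<in>{..n}. {\<omega> \<in> space M. \<theta> * t \<le> \<eta> * (\<Sum>i<j. Y i \<omega> - p)})
        = {\<omega> \<in> space M. \<exists>j\<le>n. \<theta> * t \<le> \<eta> * (\<Sum>i<j. Y i \<omega> - p)}" by auto
    finally show ?thesis .
  qed
  have "prob {\<omega> \<in> space M. \<exists>j\<le>n. t < \<bar>\<Sum>i<j. Y i \<omega> - p\<bar>}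
     \<le> prob ({\<omega> \<in> space M. \<exists>j\<le>n. \<theta> * t \<le> \<theta> * (\<Sum>i<j. Y i \<omega> - p)}
           \<union> {\<omega> \<in> space M. \<exists>j\<le>n. \<theta> * t \<le> - \<theta> * (\<Sum>i<j. Y i \<omega> - p)})"
  proof (rule finite_measure_mono[OF _ sets.Un[OF ev ev]], rule subsetI)
    fix \<omega> assume "\<omega> \<in> {\<omega> \<in> space M. \<exists>j\<le>n. t < \<bar>\<Sum>i<j. Y i \<omega> - p\<bar>}"
    then obtain j where j: "\<omega> \<in> space M" "j \<le> n" and *: "t < \<bar>\<Sum>i<j. Y i \<omega> - p\<bar>" by blast
    have "t \<le> (\<Sum>i<j. Y i \<omega> - p) \<or> t \<le> - (\<Sum>i<j. Y i \<omega> - p)" using * by linarith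
    then have "\<theta> * t \<le> \<theta> * (\<Sum>i<j. Y i \<omega> - p) \<or> \<theta> * t \<le> \<theta> * (- (\<Sum>i<j. Y i \<omega> - p))"
      using \<theta> by (meson mult_left_mono)
    with j show "\<omega> \<in> {\<omega> \<in> space M. \<exists>j\<le>n. \<theta> * t \<le> \<theta> * (\<Sum>i<j. Y i \<omega> - p)}
           \<union> {\<omega> \<in> space M. \<exists>j\<le>n. \<theta> * t \<le> - \<theta> * (\<Sum>i<j. Y i \<omega> - p)}" by auto
  qed
  also have "\<dots> \<le> prob {\<omega> \<in> space M. \<exists>j\<le>n. \<theta> * t \<le> \<theta> * (\<Sum>i<j. Y i \<omega> - p)}
           + prob {\<omega> \<in> space M. \<exists>j\<le>n. \<theta> * t \<le> - \<theta> * (\<Sum>i<j. Y i \<omega> - p)}"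
    by (rule measure_Un_le[OF ev ev])
  also have "\<dots> \<le> exp (n * v * \<theta>\<^sup>2 - \<theta> * t) + exp (n * v * (- \<theta>)\<^sup>2 - \<theta> * t)"
    using v \<theta> by (intro add_mono bernoulli_maximal_bernstein_aux[OF ind Y01 ex]) auto
  finally show ?thesis by (simp add: val)
qed

section \<open>Bracketing covers and chains of boxes\<close>

abbreviation unit_cube :: "'i set \<Rightarrow> ('i \<Rightarrow> real) set" where
  "unit_cube I \<equiv> PiE I (\<lambda>_. {0..1})"

text \<open>A positive entry is lowered by 1 repeatedly; the induction runs over the excess of the
  sum above \<open>M\<close>.\<close>

lemma ex_le_fun_sum_eq:
  fixes f :: "'i \<Rightarrow> nat"
  assumes "finite I" "M \<le> sum f I"
  shows "\<exists>g. (\<forall>i\<in>I. g i \<le> f i) \<and> sum g I = M"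
  using assms(2)
proof (induction "sum f I - M" arbitrary: f)
  case 0
  then show ?case by (intro exI[of _ f]) auto
next
  case (Suc d)
  then have "sum f I \<noteq> 0" by auto
  then obtain i where i: "i \<in> I" "f i \<noteq> 0" using assms(1) by auto
  define f' where "f' = f(i := f i - 1)"
  have "sum f I = f i + sum f (I - {i})" "sum f' I = f' i + sum f' (I - {i})"
    using assms(1) i by (auto intro: sum.remove)
  moreover have "sum f' (I - {i}) = sum f (I - {i})" by (intro sum.cong) (auto simp: f'_def)
  ultimately have "sum f I = Suc (sum f' I)" using i by (simp add: f'_def)
  with Suc have "d = sum f' I - M" "M \<le> sum f' I" by auto
  from Suc.hyps(1)[OF this] obtain g where g: "\<forall>i\<in>I. g i \<le> f' i" "sum g I = M" by blast
  have "g i \<le> f i" if "i \<in> I" for i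
    using g(1) that by (force simp: f'_def split: if_splits)
  with g show ?case by blast
qed

text \<open>Weighting each multi-index by \<open>x ^ (sum of its entries)\<close> bounds the count by
  \<open>x ^ (- M) * (1 - x) ^ (- s)\<close>; the best choice is \<open>x = M / (M + s)\<close>.\<close>

lemma card_bounded_sum_le:
  fixes I :: "'i set" and M :: nat
  assumes "finite I" "I \<noteq> {}" "0 < M"
  shows "real (card {n \<in> PiE I (\<lambda>_. {..M}). sum n I \<le> M}) \<le> (exp 1 * (M / card I + 1)) ^ card I"
proof -
  define s where "s = card I"
  have s: "0 < s" using assms by (simp add: s_def card_gt_0_iff)
  define x where "x = M / (M + s)"
  have x: "0 < x" "x < 1" using s assms by (auto simp: x_def field_simps)
  have x1: "1 - x = s / (M + s)" using s by (simp add: x_def field_simps)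
  let ?A = "{n \<in> PiE I (\<lambda>_. {..M}). sum n I \<le> M}"
  have finP: "finite (PiE I (\<lambda>_. {..M}))" using assms by (intro finite_PiE) auto
  have "card ?A * x ^ M = (\<Sum>n\<in>?A. x ^ M)" by simp
  also have "\<dots> \<le> (\<Sum>n\<in>?A. \<Prod>i\<in>I. x ^ n i)"
    using x by (intro sum_mono) (auto simp: power_sum[symmetric] intro: power_decreasing)
  also have "\<dots> \<le> (\<Sum>n\<in>PiE I (\<lambda>_. {..M}). \<Prod>i\<in>I. x ^ n i)"
    using x finP by (intro sum_mono2) (auto intro: prod_nonneg)
  also have "\<dots> = (\<Prod>i\<in>I. \<Sum>a\<le>M. x ^ a)"
    using assms by (subst prod_sum_PiE) auto
  also have "\<dots> = (\<Sum>a\<le>M. x ^ a) ^ s" by (simp add: s_def)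
  also have "\<dots> \<le> (1 / (1 - x)) ^ s"
  proof (rule power_mono)
    have "(\<Sum>a\<le>M. x ^ a) = (1 - x ^ Suc M) / (1 - x)" using x by (simp add: sum_gp0)
    also have "\<dots> \<le> 1 / (1 - x)" using x by (intro divide_right_mono) auto
    finally show "(\<Sum>a\<le>M. x ^ a) \<le> 1 / (1 - x)" .
  qed (use x in \<open>auto intro: sum_nonneg\<close>)
  finally have 1: "card ?A * x ^ M \<le> (1 / (1 - x)) ^ s" .
  have "(1 / x) ^ M = (1 + s / M) ^ M" using assms s by (simp add: x_def add_divide_distrib)
  also have "\<dots> \<le> exp (s / M) ^ M" by (intro power_mono exp_ge_add_one_self) auto
  also have "\<dots> = exp 1 ^ s" using assms by (simp add: exp_of_nat_mult[symmetric])
  finally have 2: "(1 / x) ^ M \<le> exp 1 ^ s" .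
  have "real (card ?A) = card ?A * x ^ M * (1 / x) ^ M" using x by (simp add: power_one_over)
  also have "\<dots> \<le> (1 / (1 - x)) ^ s * exp 1 ^ s"
    using 1 2 x by (intro mult_mono) auto
  also have "1 / (1 - x) = M / s + 1" using s by (simp add: x1 field_simps)
  finally show ?thesis by (simp add: s_def power_mult_distrib mult.commute)
qed

text \<open>A bracketing cover of the boxes anchored at 0, each box being represented by its upper
  corner.\<close>

definition is_bracket_cover :: "'i set \<Rightarrow> real \<Rightarrow> (('i \<Rightarrow> real) \<times> ('i \<Rightarrow> real)) set \<Rightarrow> bool" where
  "is_bracket_cover I \<epsilon> \<Delta> \<longleftrightarrow> finite \<Delta> \<and>
     (\<forall>(v, w)\<in>\<Delta>. v \<in> unit_cube I \<and> w \<in> unit_cube I \<and> (\<forall>i\<in>I. v i \<le> w i) \<and>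
        (\<Prod>i\<in>I. w i) - (\<Prod>i\<in>I. v i) \<le> \<epsilon>) \<and>
     (\<forall>y\<in>unit_cube I. \<exists>(v, w)\<in>\<Delta>. \<forall>i\<in>I. v i \<le> y i \<and> y i \<le> w i)"

text \<open>The brackets have corners on the grid of powers of \<open>q = 1 - 1 / (s * 2 ^ j)\<close>: a cell of this
  grid has measure at most \<open>1 - q ^ s \<le> 2 ^ (- j)\<close>, and a point whose coordinates have total
  exponent \<open>M\<close> spans a box of measure at most \<open>2 ^ (- j)\<close>.\<close>

lemma ex_bracket_cover:
  fixes I :: "'i set" and j :: nat
  assumes I: "finite I" "I \<noteq> {}" and j: "0 < j"
  shows "\<exists>\<Delta>. is_bracket_cover I (1 / 2 ^ j) \<Delta> \<and> real (card \<Delta>) \<le> (exp 1 * (real j * 2 ^ j + 1)) ^ card I"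
proof -
  define s where "s = card I"
  have s: "0 < s" using I by (simp add: s_def card_gt_0_iff)
  \<comment> \<open>Since \<open>q \<le> exp (- (1 / (s * 2 ^ j)))\<close>, this choice gives
    \<open>q ^ M \<le> exp (- j)\<close>, which is below \<open>2 ^ (- j)\<close>.\<close>
  define M where "M = s * (j * 2 ^ j)"
  have M: "0 < M" using s j by (simp add: M_def)
  define q :: real where "q = 1 - 1 / (s * 2 ^ j)"
  have s2: "1 \<le> real s * 2 ^ j"
  proof -
    have "1 * 1 \<le> real s * 2 ^ j" using s by (intro mult_mono) auto
    then show ?thesis by simp
  qed
  have q: "0 \<le> q" "q \<le> 1" using s2 by (auto simp: q_def field_simps)
  have qs: "1 - q ^ s \<le> 1 / 2 ^ j"
  proof -
    have "1 + real s * (q - 1) \<le> (1 + (q - 1)) ^ s" using q by (intro Bernoulli_inequality) auto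
    then show ?thesis using s by (simp add: q_def)
  qed
  have qM: "q ^ M \<le> 1 / 2 ^ j"
  proof -
    have "q \<le> exp (- (1 / (s * 2 ^ j)))" using exp_ge_add_one_self[of "- (1 / (s * 2 ^ j))"] by (simp add: q_def)
    then have "q ^ M \<le> exp (- (1 / (s * 2 ^ j))) ^ M" using q by (intro power_mono) auto
    also have "\<dots> = exp (- 1) ^ j" using s by (simp add: exp_of_nat_mult[symmetric] M_def)
    also have "\<dots> \<le> (1 / 2) ^ j"
    proof (rule power_mono)
      have "(2::real) \<le> exp 1" using exp_ge_add_one_self[of "1::real"] by simp
      then show "exp (- 1 :: real) \<le> 1 / 2" by (simp add: exp_minus field_simps)
    qed auto
    finally show ?thesis by (simp add: power_one_over)
  qed
  define A where "A = {n \<in> PiE I (\<lambda>_. {..M}). sum n I \<le> M}"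
  \<comment> \<open>At total exponent \<open>M\<close> the whole box below \<open>up n\<close> is
    already small enough, so its lower corner can be 0.\<close>
  define lo where "lo n = (\<lambda>i\<in>I. if sum n I < M then q ^ Suc (n i) else 0)" for n
  define up where "up n = (\<lambda>i\<in>I. q ^ n i)" for n
  define \<Delta> where "\<Delta> = (\<lambda>n. (lo n, up n)) ` A"
  have finA: "finite A" unfolding A_def
    by (rule finite_subset[of _ "PiE I (\<lambda>_. {..M})"]) (use I in \<open>auto intro: finite_PiE\<close>)
  have pq: "q ^ a \<in> {0..1}" for a using q by (auto intro: power_le_one)
  have cube: "lo n \<in> unit_cube I" "up n \<in> unit_cube I" for n
    using pq pq[of "Suc _"] by (auto simp: lo_def up_def)
  have lo_up: "lo n i \<le> up n i" if "i \<in> I" for n i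
    using that q by (auto simp: lo_def up_def mult_left_le_one_le)
  have vol: "(\<Prod>i\<in>I. up n i) - (\<Prod>i\<in>I. lo n i) \<le> 1 / 2 ^ j" if "n \<in> A" for n
  proof (cases "sum n I < M")
    case True
    have "(\<Prod>i\<in>I. up n i) = q ^ sum n I" by (simp add: up_def power_sum)
    moreover have "(\<Prod>i\<in>I. lo n i) = q ^ s * q ^ sum n I"
      using True by (simp add: lo_def power_sum prod.distrib s_def)
    moreover have "q ^ sum n I * (1 - q ^ s) \<le> 1 * (1 - q ^ s)"
      using q by (intro mult_right_mono) (auto intro: power_le_one)
    ultimately show ?thesis using qs by (simp add: algebra_simps)
  next
    case False
    then have "sum n I = M" using that by (simp add: A_def)
    moreover have "(\<Prod>i\<in>I. lo n i) = 0" using False I by (simp add: lo_def card_gt_0_iff)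
    moreover have "(\<Prod>i\<in>I. up n i) = q ^ sum n I" by (simp add: up_def power_sum)
    ultimately show ?thesis using qM by simp
  qed
  have cover: "\<exists>n\<in>A. \<forall>i\<in>I. lo n i \<le> y i \<and> y i \<le> up n i" if y: "y \<in> unit_cube I" for y
  proof -
    have y01: "0 \<le> y i" "y i \<le> 1" if "i \<in> I" for i using y that by (auto simp: PiE_iff)
    \<comment> \<open>The cap \<open>M\<close> keeps the set finite even for \<open>y i = 0\<close>.
      If the maxima sum to less than \<open>M\<close>, then \<open>Suc (f i) \<le> M\<close>, and
      maximality gives \<open>q ^ Suc (f i) < y i\<close>.\<close>
    define S where "S i = {n. n \<le> M \<and> y i \<le> q ^ n}" for i
    define f where "f i = Max (S i)" for i
    have S: "finite (S i)" "0 \<in> S i" if "i \<in> I" for i using y01 that by (auto simp: S_def)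
    have fS: "f i \<in> S i" if "i \<in> I" for i
      unfolding f_def using S[OF that] by (intro Max_in) auto
    have fmax: "a \<le> f i" if "a \<in> S i" "i \<in> I" for a i
      unfolding f_def using S that by (intro Max_ge) auto
    show ?thesis
    proof (cases "sum f I < M")
      case True
      define n where "n = restrict f I"
      have sn: "sum n I = sum f I" by (simp add: n_def)
      have "n \<in> A" using fS True by (auto simp: A_def sn) (auto simp: n_def S_def)
      moreover have "lo n i \<le> y i \<and> y i \<le> up n i" if i: "i \<in> I" for i
      proof
        show "y i \<le> up n i" using fS[OF i] i by (simp add: up_def n_def S_def)
        have "f i \<le> sum f I" using I i by (intro member_le_sum) auto
        then have "Suc (f i) \<le> M" using True by simp
        moreover have "Suc (f i) \<notin> S i" using fmax[of "Suc (f i)" i] i by auto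
        ultimately have "q ^ Suc (f i) < y i" by (simp add: S_def)
        then show "lo n i \<le> y i" using True i by (simp add: lo_def sn) (simp add: n_def)
      qed
      ultimately show ?thesis by blast
    next
      case False
      \<comment> \<open>Lowering the exponents to a total of exactly \<open>M\<close> only enlarges
        the upper corner, and the lower corner is then 0.\<close>
      then obtain g where g: "\<forall>i\<in>I. g i \<le> f i" "sum g I = M"
        using ex_le_fun_sum_eq[OF I(1), of M f] by auto
      define n where "n = restrict g I"
      have sn: "sum n I = M" using g by (simp add: n_def)
      have "n i \<le> M" if "i \<in> I" for i using I that by (subst sn[symmetric], intro member_le_sum) auto
      then have "n \<in> A" by (auto simp: A_def sn) (auto simp: n_def)
      moreover have "lo n i \<le> y i \<and> y i \<le> up n i" if i: "i \<in> I" for i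
      proof
        have "y i \<le> q ^ f i" using fS[OF i] by (simp add: S_def)
        also have "\<dots> \<le> q ^ g i" using g i q by (intro power_decreasing) auto
        finally show "y i \<le> up n i" using i by (simp add: up_def n_def)
        show "lo n i \<le> y i" using i y01 by (simp add: lo_def sn)
      qed
      ultimately show ?thesis by blast
    qed
  qed
  have "is_bracket_cover I (1 / 2 ^ j) \<Delta>"
    unfolding is_bracket_cover_def \<Delta>_def using finA cube lo_up vol cover
    by (auto simp del: atLeastAtMost_iff)
  moreover have "real (card \<Delta>) \<le> (exp 1 * (real j * 2 ^ j + 1)) ^ card I"
  proof -
    have "real (card \<Delta>) \<le> real (card A)" unfolding \<Delta>_def using finA by (simp add: card_image_le)
    also have "\<dots> \<le> (exp 1 * (M / card I + 1)) ^ card I"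
      unfolding A_def by (rule card_bounded_sum_le[OF I M])
    also have "M / card I = real j * 2 ^ j" using s by (simp add: M_def s_def)
    finally show ?thesis .
  qed
  ultimately show ?thesis by blast
qed

text \<open>The chain of \<open>y\<close> is built downwards: a bracket of level \<open>K\<close>
  contains \<open>y\<close>, and the predecessor of a chain point is the lower corner of a bracket,
  one level down, around that point. A link below level \<open>K\<close> is determined by its upper
  end, a lower corner of the cover of level \<open>k + 1\<close>; so the links of a level are no
  more numerous than one cover.\<close>

lemma ex_chain_links:
  fixes I :: "'i set" and K :: nat
  assumes I: "finite I" "I \<noteq> {}" and K: "0 < K"
  obtains P :: "nat \<Rightarrow> (('i \<Rightarrow> real) \<times> ('i \<Rightarrow> real)) set"
  where "\<And>k. k \<le> K \<Longrightarrow> finite (P k)"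
    and "\<And>k. k \<le> K \<Longrightarrow> real (card (P k)) \<le> (exp 1 * (real (k + 1) * 2 ^ (k + 1) + 1)) ^ card I"
    and "\<And>k v w. k \<le> K \<Longrightarrow> (v, w) \<in> P k \<Longrightarrow> v \<in> unit_cube I \<and> w \<in> unit_cube I \<and>
          (\<forall>i\<in>I. v i \<le> w i) \<and> (\<Prod>i\<in>I. w i) - (\<Prod>i\<in>I. v i) \<le> 1 / 2 ^ k"
    and "\<And>y. y \<in> unit_cube I \<Longrightarrow> \<exists>p. p 0 = (\<lambda>i\<in>I. 0) \<and> (\<forall>k\<le>K. (p k, p (Suc k)) \<in> P k) \<and>
          (\<forall>i\<in>I. p K i \<le> y i \<and> y i \<le> p (Suc K) i)"
proof -
  define bd where "bd j = (exp 1 * (real j * 2 ^ j + 1)) ^ card I" for j :: nat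
  have bd_mono: "bd j \<le> bd (Suc j)" for j
  proof -
    have "real j * 2 ^ j \<le> real (Suc j) * 2 ^ Suc j" by (intro mult_mono) auto
    then show ?thesis unfolding bd_def by (intro power_mono mult_left_mono add_mono) auto
  qed
  have "\<forall>j. \<exists>\<Delta>. 0 < j \<longrightarrow> is_bracket_cover I (1 / 2 ^ j) \<Delta> \<and> real (card \<Delta>) \<le> bd j"
    using ex_bracket_cover[OF I] unfolding bd_def by blast
  then obtain \<Delta> where \<Delta>: "is_bracket_cover I (1 / 2 ^ j) (\<Delta> j)" and card\<Delta>: "real (card (\<Delta> j)) \<le> bd j"
    if "0 < j" for j by metis
  have fin\<Delta>: "finite (\<Delta> j)" if "0 < j" for j using \<Delta>[OF that] by (simp add: is_bracket_cover_def)
  have br: "v \<in> unit_cube I \<and> w \<in> unit_cube I \<and> (\<forall>i\<in>I. v i \<le> w i) \<and>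
        (\<Prod>i\<in>I. w i) - (\<Prod>i\<in>I. v i) \<le> 1 / 2 ^ j" if "0 < j" "(v, w) \<in> \<Delta> j" for j v w
    using \<Delta>[OF that(1)] that(2) unfolding is_bracket_cover_def by blast
  have cov: "\<exists>v w. (v, w) \<in> \<Delta> j \<and> (\<forall>i\<in>I. v i \<le> y i \<and> y i \<le> w i)"
    if "0 < j" "y \<in> unit_cube I" for j y
    using \<Delta>[OF that(1)] that(2) unfolding is_bracket_cover_def by blast
  have "\<forall>j y. \<exists>v. 0 < j \<longrightarrow> y \<in> unit_cube I \<longrightarrow>
      (\<exists>w. (v, w) \<in> \<Delta> j \<and> (\<forall>i\<in>I. v i \<le> y i \<and> y i \<le> w i))"
    using cov by blast
  then obtain lo where lo: "\<exists>w. (lo j y, w) \<in> \<Delta> j \<and> (\<forall>i\<in>I. lo j y i \<le> y i \<and> y i \<le> w i)"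
    if "0 < j" "y \<in> unit_cube I" for j y by metis
  \<comment> \<open>Level 0 has no cover of its own: every chain starts at the zero corner.\<close>
  define lo' where "lo' k y = (if k = 0 then (\<lambda>i\<in>I. 0) else lo k y)" for k y
  define Q where "Q k = (\<lambda>y. (lo' k y, y)) ` fst ` \<Delta> (Suc k)" for k
  \<comment> \<open>The last link is the bracket of level \<open>K\<close> around \<open>y\<close>
    itself.\<close>
  define P where "P k = (if k = K then \<Delta> K else Q k)" for k
  have fcube: "y \<in> unit_cube I" if "y \<in> fst ` \<Delta> (Suc k)" for y k
    using br[of "Suc k"] that by force
  have chain: "\<exists>p. p 0 = (\<lambda>i\<in>I. 0) \<and> p (Suc k) = v \<and> (\<forall>l\<le>k. (p l, p (Suc l)) \<in> Q l)"
    if "v \<in> fst ` \<Delta> (Suc k)" for k v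
    using that
  proof (induction k arbitrary: v)
    case 0
    then have "((\<lambda>i\<in>I. 0), v) \<in> Q 0" unfolding Q_def lo'_def by (simp only: simp_thms if_True) blast
    then show ?case
      by (intro exI[of _ "case_nat (\<lambda>i\<in>I. 0) (\<lambda>_. v)"]) (simp del: restrict_apply)
  next
    case (Suc k)
    have "lo (Suc k) v \<in> fst ` \<Delta> (Suc k)" using lo[of "Suc k" v] fcube[OF Suc.prems] by force
    from Suc.IH[OF this] obtain p where p: "p 0 = (\<lambda>i\<in>I. 0)" "p (Suc k) = lo (Suc k) v"
      "\<And>l. l \<le> k \<Longrightarrow> (p l, p (Suc l)) \<in> Q l" by blast
    have "(lo (Suc k) v, v) \<in> Q (Suc k)" using Suc.prems by (auto simp: Q_def lo'_def)
    then show ?case using p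
      by (intro exI[of _ "p(Suc (Suc k) := v)"]) (auto simp: le_Suc_eq)
  qed
  show thesis
  proof (rule that[of P])
    fix k assume k: "k \<le> K"
    show "finite (P k)" using fin\<Delta> K by (auto simp: P_def Q_def)
    show "real (card (P k)) \<le> (exp 1 * (real (k + 1) * 2 ^ (k + 1) + 1)) ^ card I"
    proof (cases "k = K")
      case True
      then show ?thesis using card\<Delta>[OF K] bd_mono[of K] by (simp add: P_def bd_def)
    next
      case False
      have "card (Q k) \<le> card (\<Delta> (Suc k))"
        unfolding Q_def using fin\<Delta>[of "Suc k"]
        by (intro order_trans[OF card_image_le] card_image_le) auto
      then have "real (card (Q k)) \<le> bd (Suc k)" using card\<Delta>[of "Suc k"] by simp
      then show ?thesis using False by (simp add: P_def bd_def)
    qed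
  next
    fix k v w assume k: "k \<le> K" and vw: "(v, w) \<in> P k"
    show "v \<in> unit_cube I \<and> w \<in> unit_cube I \<and>
          (\<forall>i\<in>I. v i \<le> w i) \<and> (\<Prod>i\<in>I. w i) - (\<Prod>i\<in>I. v i) \<le> 1 / 2 ^ k"
    proof (cases "k = K")
      case True
      then show ?thesis using vw br[OF K] by (simp add: P_def)
    next
      case False
      then have w: "w \<in> fst ` \<Delta> (Suc k)" and v: "v = lo' k w" using vw by (auto simp: P_def Q_def)
      have wc: "w \<in> unit_cube I" by (rule fcube[OF w])
      show ?thesis
      proof (cases "k = 0")
        case True
        have "(\<Prod>i\<in>I. w i) \<le> 1" using wc by (intro prod_le_1) (auto simp: PiE_iff)
        moreover have "(0::real) \<le> 0 ^ card I" by simp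
        ultimately have "prod w I - 0 ^ card I \<le> 1" by linarith
        then show ?thesis using True v wc by (auto simp: lo'_def PiE_iff)
      next
        case False
        \<comment> \<open>\<open>w\<close> lies in a bracket of level \<open>k\<close> with lower
          corner \<open>v\<close>, so the link has no larger volume difference than this
          bracket.\<close>
        then obtain u where u: "(v, u) \<in> \<Delta> k" "\<forall>i\<in>I. v i \<le> w i \<and> w i \<le> u i"
          using lo[of k w] wc v by (auto simp: lo'_def)
        have "(\<Prod>i\<in>I. w i) \<le> (\<Prod>i\<in>I. u i)" using u wc by (intro prod_mono) (auto simp: PiE_iff)
        then show ?thesis using br[OF _ u(1)] False u wc by auto
      qed
    qed
  next
    fix y assume y: "y \<in> unit_cube I"
    obtain v w where vw: "(v, w) \<in> \<Delta> K" "\<forall>i\<in>I. v i \<le> y i \<and> y i \<le> w i" using cov[OF K y] by blast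
    have "v \<in> fst ` \<Delta> (Suc (K - 1))" using vw K by force
    from chain[OF this] obtain p where p: "p 0 = (\<lambda>i\<in>I. 0)" "p K = v"
      "\<And>l. l < K \<Longrightarrow> (p l, p (Suc l)) \<in> Q l" using K by auto
    show "\<exists>p. p 0 = (\<lambda>i\<in>I. 0) \<and> (\<forall>k\<le>K. (p k, p (Suc k)) \<in> P k) \<and>
          (\<forall>i\<in>I. p K i \<le> y i \<and> y i \<le> p (Suc K) i)"
      using p vw by (intro exI[of _ "p(Suc K := w)"]) (auto simp: P_def le_less)
  qed
qed

section \<open>Star discrepancy and unnormalised box deviations\<close>

definition box_deviation :: "nat \<Rightarrow> nat \<Rightarrow> (nat \<Rightarrow> nat \<Rightarrow> real) \<Rightarrow> (nat \<Rightarrow> real) \<Rightarrow> real" where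
  "box_deviation s N x y =
     real (card {k \<in> {1..N}. \<forall>i\<in>{1..s}. 0 \<le> x k i \<and> x k i < y i}) - N * (\<Prod>i\<in>{1..s}. y i)"

text \<open>Without the factor \<open>1 / N\<close> the local discrepancy is a partial sum in
  \<open>N\<close>, to which a maximal inequality applies. The points are numbered from 1, hence
  \<open>Suc n\<close>.\<close>

lemma box_deviation_eq_sum:
  "box_deviation s N x y =
     (\<Sum>n<N. of_bool (\<forall>i\<in>{1..s}. 0 \<le> x (Suc n) i \<and> x (Suc n) i < y i) - (\<Prod>i\<in>{1..s}. y i))"
proof -
  have "real (card {k \<in> {1..N}. P k}) = (\<Sum>k\<in>{1..N}. of_bool (P k))" for P
    by (simp add: Int_def)
  also have "(\<Sum>k\<in>{1..N}. of_bool (P k)) = (\<Sum>n<N. of_bool (P (Suc n)) :: real)" for P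
    by (simp add: sum.atLeast1_atMost_eq)
  finally show ?thesis unfolding box_deviation_def by (simp add: sum_subtractf)
qed

lemma star_discrepancy_term:
  "0 < N \<Longrightarrow> \<bar>real (card {k \<in> {1..N}. \<forall>i\<in>{1..s}. 0 \<le> x k i \<and> x k i < y i}) / real N
      - (\<Prod>i\<in>{1..s}. y i)\<bar> = \<bar>box_deviation s N x y\<bar> / N"
proof -
  assume "0 < N"
  then have "real (card {k \<in> {1..N}. \<forall>i\<in>{1..s}. 0 \<le> x k i \<and> x k i < y i}) / real N
      - (\<Prod>i\<in>{1..s}. y i) = box_deviation s N x y / N"
    by (simp add: box_deviation_def field_simps)
  then show ?thesis by simp
qed

lemma star_discrepancy_eq:
  "0 < N \<Longrightarrow> star_discrepancy s N x = (SUP y \<in> unit_cube {1..s}. \<bar>box_deviation s N x y\<bar> / N)"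
  unfolding star_discrepancy_def by (simp only: star_discrepancy_term)

lemma unit_cube_nonempty: "unit_cube I \<noteq> {}"
  by (auto simp: PiE_eq_empty_iff)

lemma abs_box_deviation_le:
  assumes "y \<in> unit_cube {1..s}"
  shows "\<bar>box_deviation s N x y\<bar> \<le> N"
proof -
  have "card {k \<in> {1..N}. \<forall>i\<in>{1..s}. 0 \<le> x k i \<and> x k i < y i} \<le> card {1..N}"
    by (intro card_mono) auto
  then have c: "real (card {k \<in> {1..N}. \<forall>i\<in>{1..s}. 0 \<le> x k i \<and> x k i < y i}) \<le> N" by simp
  have "(\<Prod>i\<in>{1..s}. y i) \<le> 1" "0 \<le> (\<Prod>i\<in>{1..s}. y i)"
    using assms by (auto simp: PiE_iff intro: prod_le_1 prod_nonneg)
  then have "N * (\<Prod>i\<in>{1..s}. y i) \<le> N * 1" "0 \<le> N * (\<Prod>i\<in>{1..s}. y i)" using mult_left_mono[of "\<Prod>i\<in>{1..s}. y i" 1 "real N"] by (simp_all add: mult.commute)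
  with c show ?thesis unfolding box_deviation_def by linarith
qed

lemma star_discrepancy_le_iff:
  assumes "0 < N"
  shows "star_discrepancy s N x \<le> c \<longleftrightarrow> (\<forall>y\<in>unit_cube {1..s}. \<bar>box_deviation s N x y\<bar> \<le> c * N)"
proof -
  have "bdd_above ((\<lambda>y. \<bar>box_deviation s N x y\<bar> / N) ` unit_cube {1..s})"
    using abs_box_deviation_le assms by (intro bdd_aboveI[of _ 1]) auto
  then show ?thesis unfolding star_discrepancy_eq[OF assms] using assms
    by (subst cSUP_le_iff) (auto simp: unit_cube_nonempty pos_divide_le_eq)
qed

text \<open>Telescoping from the empty box at \<open>p 0\<close> bounds the deviations at
  \<open>p K\<close> and \<open>p (Suc K)\<close>. Counts and volumes are monotone in the corner, so
  the deviation at \<open>y\<close> costs at most \<open>N\<close> times the volume of the last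
  bracket in addition.\<close>

lemma abs_box_deviation_chain_le:
  fixes p :: "nat \<Rightarrow> nat \<Rightarrow> real"
  assumes s: "0 < s" and p0: "p 0 = (\<lambda>i\<in>{1..s}. 0)"
    and pc: "p K \<in> unit_cube {1..s}" and y: "\<forall>i\<in>{1..s}. p K i \<le> y i \<and> y i \<le> p (Suc K) i"
    and vol: "(\<Prod>i\<in>{1..s}. p (Suc K) i) - (\<Prod>i\<in>{1..s}. p K i) \<le> 1 / 2 ^ K"
    and link: "\<And>k. k \<le> K \<Longrightarrow> \<bar>box_deviation s N x (p (Suc k)) - box_deviation s N x (p k)\<bar> \<le> t k"
  shows "\<bar>box_deviation s N x y\<bar> \<le> (\<Sum>k\<le>K. t k) + N / 2 ^ K"
proof -
  define F where "F = box_deviation s N x"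
  define H where "H z = real (card {k \<in> {1..N}. \<forall>i\<in>{1..s}. 0 \<le> x k i \<and> x k i < z i})" for z
  define V where "V z = (\<Prod>i\<in>{1..s}. z i)" for z :: "nat \<Rightarrow> real"
  have F: "F z = H z - N * V z" for z by (simp add: F_def H_def V_def box_deviation_def)
  have Hmono: "H z \<le> H z'" if "\<forall>i\<in>{1..s}. z i \<le> z' i" for z z'
    unfolding H_def using that by (intro of_nat_mono card_mono) (auto intro: less_le_trans)
  have Vmono: "V z \<le> V z'" if "\<forall>i\<in>{1..s}. 0 \<le> z i \<and> z i \<le> z' i" for z z'
    unfolding V_def using that by (intro prod_mono) auto
  have p01: "\<forall>i\<in>{1..s}. 0 \<le> p K i" using pc by (auto simp: PiE_iff)
  have y0: "\<forall>i\<in>{1..s}. 0 \<le> y i" using y p01 by (meson order_trans)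
  have "F (p 0) = 0"
  proof -
    have "{k \<in> {1..N}. \<forall>i\<in>{1..s}. 0 \<le> x k i \<and> x k i < p 0 i} = {}" using s by (force simp: p0)
    moreover have "V (p 0) = 0" using s by (auto simp: V_def p0)
    ultimately show ?thesis unfolding F H_def by simp
  qed
  \<comment> \<open>Both ends of link \<open>k\<close> are carried along because \<open>y\<close> is
    finally sandwiched between \<open>p K\<close> and \<open>p (Suc K)\<close>.\<close>
  have tele: "\<bar>F (p (Suc k))\<bar> \<le> (\<Sum>l\<le>k. t l) \<and> (\<bar>F (p k)\<bar> \<le> (\<Sum>l\<le>k. t l))" if "k \<le> K" for k
    using that
  proof (induction k)
    case 0
    then show ?case using link[of 0] \<open>F (p 0) = 0\<close> unfolding F_def[symmetric] by simp
  next
    case (Suc k)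
    then show ?case using link[of "Suc k"] unfolding F_def[symmetric] sum.atMost_Suc by force
  qed
  have lin: "N * V (p (Suc K)) - N * V (p K) \<le> N / 2 ^ K"
    using mult_left_mono[OF vol, of "real N"] by (simp add: V_def algebra_simps)
  have "N * V (p K) \<le> N * V y" "N * V y \<le> N * V (p (Suc K))"
    using y p01 y0 by (auto intro!: mult_left_mono Vmono)
  moreover have "H (p K) \<le> H y" "H y \<le> H (p (Suc K))" using y by (auto intro!: Hmono)
  ultimately have "F (p K) - N / 2 ^ K \<le> F y" "F y \<le> F (p (Suc K)) + N / 2 ^ K"
    using lin unfolding F by linarith+
  then show ?thesis using tele[of K] unfolding F_def by linarith
qed

text \<open>Supplies the depth of the chain. Minimality of \<open>K\<close> gives the upper bound,
  and \<open>4 < x\<close> excludes the powers up to \<open>2 ^ 2\<close>.\<close>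

lemma ex_pow2_between:
  fixes x :: real
  assumes "4 < x"
  obtains K where "3 \<le> K" "x \<le> 2 ^ K" "2 ^ K < 2 * x"
proof -
  define K where "K = (LEAST K. x \<le> 2 ^ K)"
  obtain n where "x < 2 ^ n" using real_arch_pow[of 2 x] by auto
  then have K: "x \<le> 2 ^ K" unfolding K_def by (rule LeastI[of "\<lambda>K. x \<le> 2 ^ K" n, OF less_imp_le])
  have "3 \<le> K"
  proof (rule ccontr)
    assume "\<not> 3 \<le> K"
    then have "(2::real) ^ K \<le> 2 ^ 2" by (intro power_increasing) auto
    then show False using K assms by simp
  qed
  then obtain j where j: "K = Suc j" by (cases K) auto
  have "\<not> x \<le> 2 ^ j" using not_less_Least[of j "\<lambda>K. x \<le> 2 ^ K"] j by (simp add: K_def)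
  then have "2 ^ K < 2 * x" by (simp add: j)
  with that K \<open>3 \<le> K\<close> show thesis by blast
qed

section \<open>The constants\<close>

text \<open>The factor \<open>L_k\<close> in \<open>a_k = b_k * L_k\<close>; its exponential is
  compared with the number of links of level \<open>k\<close>.\<close>

definition log_term :: "nat \<Rightarrow> nat \<Rightarrow> real" where
  "log_term s k = ln (C_const s * 2 ^ (k + 2) * sqrt (2 / pi)) / real s
                    + ln (2 * exp 1 * (2 ^ (k + 1) + 1))"

definition sqrt_sum :: "nat \<Rightarrow> real" where
  "sqrt_sum s = sqrt (a_coef s 0) + (\<Sum>k. sqrt (a_coef s k))"

lemma a_coef_eq: "a_coef s k = b_coef k * log_term s k"
  by (simp add: a_coef_def log_term_def)

lemma A_const_eq: "A_const s = 2 * (sqrt_sum s)\<^sup>2"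
  by (simp add: A_const_def sqrt_sum_def)

lemma b_coef_eq: "0 < k \<Longrightarrow> b_coef k = 8 / 2 ^ k * (1 - 1 / 2 ^ k)"
  by (simp add: b_coef_def powr_diff powr_minus powr_realpow inverse_eq_divide)

lemma b_coef_0 [simp]: "b_coef 0 = 3"
  by (simp add: b_coef_def)

lemma b_coef_pos: "0 < b_coef k"
proof (cases "k = 0")
  case False
  then have "(1::real) < 2 ^ k" by simp
  then have "0 < 8 / 2 ^ k * (1 - 1 / (2::real) ^ k)" by (intro mult_pos_pos) auto
  then show ?thesis using False by (simp only: b_coef_eq)
qed simp

lemma b_coef_le: "b_coef k \<le> 8 / 2 ^ k"
proof (cases "k = 0")
  case False
  have "8 / 2 ^ k * (1 - 1 / 2 ^ k) \<le> 8 / 2 ^ k * (1::real)" by (intro mult_left_mono) auto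
  then show ?thesis using False by (simp add: b_coef_eq)
qed simp

text \<open>The variance increases in \<open>p\<close> on \<open>[0, 1 / 2]\<close>, and for
  \<open>k > 0\<close> its value at \<open>2 ^ (- k)\<close> is \<open>b_k / 8\<close>. For
  \<open>k = 0\<close> it never exceeds \<open>1 / 4\<close>, which is below
  \<open>3 / 8\<close>.\<close>

lemma bernoulli_variance_le_b_coef:
  assumes "0 \<le> p" "p \<le> 1 / 2 ^ k"
  shows "p * (1 - p) \<le> b_coef k / 8"
proof (cases "k = 0")
  case True
  have "0 \<le> (p - 1 / 2)\<^sup>2" by simp
  then have "p * (1 - p) \<le> 1 / 4" by (simp add: power2_eq_square algebra_simps)
  then show ?thesis using True by simp
next
  case False
  define e :: real where "e = 1 / 2 ^ k"
  have "(2::real) ^ 1 \<le> 2 ^ k" using False by (intro power_increasing) auto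
  then have e: "e \<le> 1 / 2" unfolding e_def by (simp add: field_simps)
  have p: "0 \<le> e - p" "0 \<le> 1 - e - p" using assms e unfolding e_def[symmetric] by linarith+
  have "0 \<le> (e - p) * (1 - e - p)" using p by (rule mult_nonneg_nonneg)
  then have "p * (1 - p) \<le> e * (1 - e)" by (simp add: algebra_simps)
  moreover have "b_coef k = 8 * (e * (1 - e))" using False by (simp add: b_coef_eq e_def)
  ultimately show ?thesis by linarith
qed

lemma C_const_ge_1: "1 \<le> C_const s"
  by (simp add: C_const_def)

section \<open>Growth of the logarithmic factor in \<open>k\<close>\<close>

lemma ln_2_le: "ln 2 \<le> (0.693148::real)"
  using ln_approx_bounds[of 2 5] by (simp add: eval_nat_numeral)

lemma log_term_expand:
  "log_term s k = ln (C_const s * 4 * sqrt (2 / pi)) / s + k * ln 2 / s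
     + 1 + ln 2 + ln (2 ^ (k + 1) + 1)"
proof -
  have C: "0 < C_const s * 4 * sqrt (2 / pi)" using C_const_ge_1[of s] pi_gt_zero by simp
  have eq: "C_const s * 2 ^ (k + 2) * sqrt (2 / pi) = (C_const s * 4 * sqrt (2 / pi)) * 2 ^ k"
    by (simp add: power_add)
  have "ln (C_const s * 2 ^ (k + 2) * sqrt (2 / pi)) = ln (C_const s * 4 * sqrt (2 / pi)) + k * ln 2"
    unfolding eq using C by (subst ln_mult_pos) (auto simp: ln_realpow)
  moreover have "ln (2 * exp 1 * (2 ^ (k + 1) + 1) :: real) = 1 + ln 2 + ln (2 ^ (k + 1) + 1)"
  proof -
    have "0 < (2::real) ^ (k + 1) + 1" by (simp add: add_pos_pos)
    then show ?thesis by (simp add: ln_mult_pos)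
  qed
  ultimately show ?thesis by (simp add: log_term_def add_divide_distrib)
qed

lemma ln_pow2_plus1_le: "ln (2 ^ (k + 1) + 1) \<le> ln 3 + k * ln (2::real)"
proof -
  have "(2::real) ^ (k + 1) + 1 \<le> 3 * 2 ^ k" by simp
  then have "ln ((2::real) ^ (k + 1) + 1) \<le> ln (3 * 2 ^ k)" by (subst ln_le_cancel_iff) (auto simp: add_pos_pos)
  also have "\<dots> = ln 3 + k * ln 2" by (simp add: ln_mult_pos ln_realpow)
  finally show ?thesis .
qed

text \<open>The summand \<open>1 / s\<close> comes from \<open>exp 1 \<le> 4 * 0.7\<close>, where
  0.7 is a lower bound of \<open>sqrt (2 / pi)\<close>; the constant 2.7 comes from
  \<open>1 + ln 2 + ln 3\<close>.\<close>

lemma log_term_0_ge: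
  assumes "0 < s"
  shows "1 / s + 2.7 \<le> log_term s 0"
proof -
  have "1 \<le> ln (C_const s * 4 * sqrt (2 / pi))"
  proof -
    have "0.7\<^sup>2 \<le> 2 / pi" using pi_less_4 pi_gt_zero by (simp add: field_simps)
    then have "0.7 \<le> sqrt (2 / pi)" by (rule real_le_rsqrt)
    then have "1 * 4 * 0.7 \<le> C_const s * 4 * sqrt (2 / pi)"
      using C_const_ge_1[of s] by (intro mult_mono) auto
    moreover have "exp 1 \<le> (2.8::real)" using e_less_272 by simp
    ultimately have "exp 1 \<le> C_const s * 4 * sqrt (2 / pi)" by simp
    then show ?thesis by (metis exp_gt_zero ln_exp ln_mono)
  qed
  then have "1 / s \<le> ln (C_const s * 4 * sqrt (2 / pi)) / s" by (intro divide_right_mono) auto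
  moreover have "ln 3 \<ge> (1::real)" using ln3_gt_1 by simp
  ultimately show ?thesis using ln2_ge_two_thirds ln_approx_bounds[of 3 3]
    by (simp add: log_term_expand eval_nat_numeral)
qed

text \<open>Each level adds at most \<open>ln 2 * (1 / s + 1)\<close>, and the lower bound at level
  0 makes this at most \<open>0.4 * log_term s 0\<close>.\<close>

lemma log_term_le:
  assumes "0 < s"
  shows "log_term s k \<le> log_term s 0 * (1 + 0.4 * k)"
proof -
  have s1: "1 / s \<le> (1::real)" using assms by simp
  have "log_term s k - log_term s 0 \<le> k * ln 2 / s + k * ln 2"
    using ln_pow2_plus1_le[of k] by (simp add: log_term_expand)
  also have "\<dots> = k * (ln 2 * (1 / s + 1))" by (simp add: algebra_simps)
  also have "\<dots> \<le> k * (0.4 * log_term s 0)"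
  proof (rule mult_left_mono)
    have "ln 2 * (1 / s + 1) \<le> 0.693148 * (1 / s + 1)" using ln_2_le by (intro mult_right_mono) auto
    also have "\<dots> \<le> 0.4 * (1 / s + 2.7)" using s1 by (simp add: algebra_simps)
    also have "\<dots> \<le> 0.4 * log_term s 0" using log_term_0_ge[OF assms] by simp
    finally show "ln 2 * (1 / s + 1) \<le> 0.4 * log_term s 0" .
  qed auto
  finally show ?thesis by (simp add: algebra_simps)
qed

lemma log_term_0_le: "log_term s 0 \<le> log_term s k"
proof -
  define x where "x = k * ln 2 / real s"
  have "0 \<le> x" by (simp add: x_def)
  moreover have "ln 3 \<le> ln ((2::real) ^ (k + 1) + 1)"
  proof -
    have "(1::real) \<le> 2 ^ k" by simp
    then have "(3::real) \<le> 2 ^ (k + 1) + 1" by (simp del: one_le_power)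
    then show ?thesis by (intro ln_mono) auto
  qed
  ultimately show ?thesis unfolding log_term_expand x_def[symmetric] by simp
qed

lemma log_term_pos: "0 < s \<Longrightarrow> 0 < log_term s k"
proof -
  assume "0 < s"
  then have "0 < 1 / s + 2.7" by (simp add: add_nonneg_pos)
  then show ?thesis using log_term_0_ge[OF \<open>0 < s\<close>] log_term_0_le[of s k] by linarith
qed

lemma a_coef_pos: "0 < s \<Longrightarrow> 0 < a_coef s k"
  by (simp add: a_coef_eq b_coef_pos log_term_pos)

text \<open>From \<open>1 + 2 * d * j \<le> (1 + d * j)\<^sup>2\<close>, the terms are at most
  \<open>c * (1 + d * j) * r ^ j\<close> with \<open>r\<close> slightly above
  \<open>1 / sqrt 2\<close>. Writing \<open>1 + d * j\<close> as
  \<open>(1 - d) + d * (j + 1)\<close> leads to \<open>1 / (1 - r)\<close> and its square, which the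
  two decimals bound from above.\<close>

lemma sqrt_tail_sum:
  fixes f :: "nat \<Rightarrow> real"
  assumes f: "\<And>j. 0 \<le> f j" "\<And>j. f j \<le> c\<^sup>2 * (1 + 2 * d * j) / 2 ^ j"
    and c: "0 \<le> c" and d: "0 \<le> d" "d \<le> 1"
  shows "summable (\<lambda>j. sqrt (f j))" (is ?A)
    and "(\<Sum>j. sqrt (f j)) \<le> c * ((1 - d) * 3.41422 + d * 11.6569)" (is ?B)
proof -
  define r :: real where "r = 0.707107"
  define g where "g j = c * ((1 - d) * r ^ j + d * (real (Suc j) * r ^ j))" for j
  have r: "norm r < 1" "0 \<le> r" "1 / 2 \<le> r\<^sup>2" by (simp_all add: r_def power2_eq_square)
  have gs: "g sums (c * ((1 - d) * (1 / (1 - r)) + d * (1 / (1 - r)\<^sup>2)))"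
    unfolding g_def
    by (intro sums_mult sums_add geometric_sums[OF r(1)] geometric_deriv_sums[OF r(1), simplified of_nat_Suc[symmetric]])
  have fg: "sqrt (f j) \<le> g j" for j
  proof (rule real_le_lsqrt)
    have g: "g j = c * (1 + d * j) * r ^ j" by (simp add: g_def algebra_simps)
    then show "0 \<le> g j" using c d r by simp
    have "f j \<le> c\<^sup>2 * (1 + 2 * d * j) * (1 / 2) ^ j" using f(2)[of j] by (simp add: power_one_over)
    also have "\<dots> \<le> c\<^sup>2 * (1 + d * j)\<^sup>2 * (r\<^sup>2) ^ j"
    proof (intro mult_mono mult_left_mono power_mono)
      have "(1 + d * j)\<^sup>2 = 1 + 2 * d * j + (d * j)\<^sup>2" by (simp add: power2_eq_square algebra_simps)
      then show "1 + 2 * d * j \<le> (1 + d * j)\<^sup>2" by simp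
    qed (use r c d in auto)
    also have "\<dots> = (g j)\<^sup>2" by (simp add: g power_mult_distrib power_mult[symmetric] mult.commute)
    finally show "f j \<le> (g j)\<^sup>2" .
  qed
  show ?A by (rule summable_comparison_test'[OF sums_summable[OF gs]]) (use f fg in auto)
  then have "(\<Sum>j. sqrt (f j)) \<le> (\<Sum>j. g j)" using fg sums_summable[OF gs] by (intro suminf_le) auto
  also have "\<dots> = c * ((1 - d) * (1 / (1 - r)) + d * (1 / (1 - r)\<^sup>2))" using gs by (simp add: sums_iff)
  also have "\<dots> \<le> c * ((1 - d) * 3.41422 + d * 11.6569)"
    using c d by (intro mult_left_mono add_mono) (auto simp: r_def power2_eq_square)
  finally show ?B .
qed

section \<open>Size of the sum \<open>S\<close>\<close>

lemma summable_sqrt_a_coef: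
  assumes s: "0 < s"
  shows "summable (\<lambda>k. sqrt (a_coef s k))"
proof (rule sqrt_tail_sum(1))
  fix k
  have "a_coef s k \<le> 8 / 2 ^ k * (log_term s 0 * (1 + 0.4 * k))"
    unfolding a_coef_eq using b_coef_le log_term_le[OF s] log_term_pos[OF s] b_coef_pos
    by (intro mult_mono) (auto intro: less_imp_le)
  also have "\<dots> = (sqrt (8 * log_term s 0))\<^sup>2 * (1 + 2 * 0.2 * k) / 2 ^ k"
    using log_term_pos[OF s, of 0] by simp
  finally show "a_coef s k \<le> (sqrt (8 * log_term s 0))\<^sup>2 * (1 + 2 * 0.2 * k) / 2 ^ k" .
qed (use a_coef_pos[OF s] log_term_pos[OF s, of 0] in \<open>auto intro: less_imp_le\<close>)

lemma sum_sqrt_a_coef_le_sqrt_sum: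
  assumes s: "0 < s"
  shows "sqrt (a_coef s 0) + (\<Sum>k\<le>K. sqrt (a_coef s k)) \<le> sqrt_sum s"
  unfolding sqrt_sum_def using a_coef_pos[OF s]
  by (intro add_left_mono sum_le_suminf summable_sqrt_a_coef[OF s]) (auto intro: less_imp_le)

text \<open>The term of level 0 occurs twice in \<open>S\<close>, for the indices -1 and 0. As
  \<open>L_k \<ge> L_0\<close>, levels 1 to 3 exceed two further copies:
  \<open>1.41 + 1.22 + 0.93 > 2 * 1.7321\<close>. This forces a chain depth of at least 3 whenever
  the trivial bound does not suffice.\<close>

lemma sqrt_sum_gt:
  assumes s: "0 < s"
  shows "4 * sqrt (a_coef s 0) < sqrt_sum s"
proof -
  define l where "l = sqrt (log_term s 0)"
  have l: "0 < l" using log_term_pos[OF s] by (simp add: l_def)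
  have ge: "x * l \<le> sqrt (a_coef s k)" if "x\<^sup>2 \<le> b_coef k" for x k
  proof -
    have "x * l \<le> sqrt (b_coef k) * sqrt (log_term s k)"
      using that log_term_0_le[of s k] l b_coef_pos[of k] unfolding l_def
      by (intro mult_mono real_le_rsqrt) (auto intro: less_imp_le)
    then show ?thesis by (simp add: a_coef_eq real_sqrt_mult)
  qed
  have "sqrt 3 < (1.7321::real)" by (rule real_less_lsqrt) (auto simp: power2_eq_square)
  then have "sqrt 3 * l < 1.7321 * l" using l by (intro mult_strict_right_mono) auto
  then have "sqrt (a_coef s 0) < 1.7321 * l" by (simp add: a_coef_eq l_def real_sqrt_mult)
  moreover have "1.41 * l \<le> sqrt (a_coef s 1)" "1.22 * l \<le> sqrt (a_coef s 2)" "0.93 * l \<le> sqrt (a_coef s 3)"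
    by (rule ge; simp add: b_coef_eq power2_eq_square)+
  moreover have "sqrt (a_coef s 0) + (\<Sum>k\<le>3. sqrt (a_coef s k)) \<le> sqrt_sum s"
    by (rule sum_sqrt_a_coef_le_sqrt_sum[OF s])
  moreover have "(\<Sum>k\<le>3. sqrt (a_coef s k))
      = sqrt (a_coef s 0) + sqrt (a_coef s 1) + sqrt (a_coef s 2) + sqrt (a_coef s 3)"
    by (simp add: numeral_3_eq_3 numeral_2_eq_2)
  ultimately show ?thesis using l by simp
qed

lemma sqrt_le_of_sq: "x \<le> y * y \<Longrightarrow> 0 \<le> y \<Longrightarrow> sqrt x \<le> y" for x y :: real
  by (intro real_le_lsqrt) (auto simp: power2_eq_square)

text \<open>The additional \<open>r 0\<close> accounts for the index -1.\<close>

lemma sqrt_sum_le_split: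
  assumes s: "0 < s" and tail: "(\<Sum>j. sqrt (a_coef s (j + n))) \<le> u"
    and r: "\<And>k. k < n \<Longrightarrow> sqrt (a_coef s k) \<le> r k" and n: "0 < n"
  shows "sqrt_sum s \<le> r 0 + (\<Sum>k<n. r k) + u"
proof -
  have "(\<Sum>k. sqrt (a_coef s k)) = (\<Sum>j. sqrt (a_coef s (j + n))) + (\<Sum>k<n. sqrt (a_coef s k))"
    by (rule suminf_split_initial_segment[OF summable_sqrt_a_coef[OF s]])
  moreover have "(\<Sum>k<n. sqrt (a_coef s k)) \<le> (\<Sum>k<n. r k)" using r by (intro sum_mono) auto
  ultimately show ?thesis using tail r[OF n] by (simp add: sqrt_sum_def)
qed

text \<open>Origin of the constant 178: \<open>S\<close> is at most 13.3 times the square root of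
  \<open>L_0\<close>, and \<open>13.3\<^sup>2 = 176.89\<close>.\<close>

lemma sqrt_sum_sq_le:
  assumes s: "0 < s"
  shows "(sqrt_sum s)\<^sup>2 \<le> 178 * log_term s 0"
proof -
  define l where "l = sqrt (log_term s 0)"
  have L: "0 < log_term s 0" using log_term_pos[OF s] .
  have l: "0 < l" using L by (simp add: l_def)
  \<comment> \<open>Upper roundings of \<open>sqrt (b_coef k * (1 + 0.4 * k))\<close> for
    \<open>k < 10\<close>.\<close>
  define rs :: "real list" where "rs = [1.7321, 1.6734, 1.6432, 1.388, 1.105, 0.853, 0.647, 0.486, 0.362, 0.268]"
  have up: "sqrt (a_coef s k) \<le> rs ! k * l" if "k < 10" for k
  proof -
    have "b_coef k * (1 + 0.4 * k) \<le> rs ! k * rs ! k \<and> 0 \<le> rs ! k"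
      using that by (auto simp: eval_nat_numeral less_Suc_eq b_coef_eq rs_def)
    then have *: "sqrt (b_coef k * (1 + 0.4 * k)) \<le> rs ! k" by (intro sqrt_le_of_sq) auto
    have "a_coef s k \<le> (b_coef k * (1 + 0.4 * k)) * log_term s 0"
      using mult_left_mono[OF log_term_le[OF s, of k], of "b_coef k"] b_coef_pos[of k]
      by (simp add: a_coef_eq mult_ac)
    then have "sqrt (a_coef s k) \<le> sqrt (b_coef k * (1 + 0.4 * k)) * l"
      unfolding l_def real_sqrt_mult[symmetric] by simp
    also have "\<dots> \<le> rs ! k * l" using * l by (intro mult_right_mono) auto
    finally show ?thesis .
  qed
  \<comment> \<open>As \<open>1 + 0.4 * (j + 10) = 5 * (1 + 2 * 0.04 * j)\<close>, the tail has
    \<open>d = 0.04\<close> and \<open>c\<close> just above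
    \<open>l * sqrt (40 / 1024)\<close>.\<close>
  have tail: "(\<Sum>j. sqrt (a_coef s (j + 10))) \<le> (0.198 * l) * ((1 - 0.04) * 3.41422 + 0.04 * 11.6569)"
  proof (rule sqrt_tail_sum(2))
    fix j
    have "a_coef s (j + 10) \<le> 8 / 2 ^ (j + 10) * (log_term s 0 * (1 + 0.4 * real (j + 10)))"
      unfolding a_coef_eq using log_term_pos[OF s] b_coef_pos
      by (intro mult_mono b_coef_le log_term_le[OF s]) (auto intro: less_imp_le)
    also have "\<dots> = log_term s 0 * ((40 / 1024) * (1 + 2 * 0.04 * j)) / 2 ^ j"
      by (simp add: power_add field_simps)
    also have "\<dots> \<le> log_term s 0 * (0.198\<^sup>2 * (1 + 2 * 0.04 * j)) / 2 ^ j"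
      using L by (intro divide_right_mono mult_left_mono mult_right_mono) (auto simp: power2_eq_square)
    also have "\<dots> = (0.198 * l)\<^sup>2 * (1 + 2 * 0.04 * j) / 2 ^ j"
      using L by (simp add: l_def power_mult_distrib power_divide)
    finally show "a_coef s (j + 10) \<le> (0.198 * l)\<^sup>2 * (1 + 2 * 0.04 * j) / 2 ^ j" .
  qed (use a_coef_pos[OF s] l in \<open>auto intro: less_imp_le\<close>)
  have "sqrt_sum s \<le> rs ! 0 * l + (\<Sum>k<10. rs ! k * l) + (0.198 * l) * ((1 - 0.04) * 3.41422 + 0.04 * 11.6569)"
    by (rule sqrt_sum_le_split[OF s tail up]) auto
  also have "\<dots> \<le> 13.3 * l" using l by (simp add: rs_def eval_nat_numeral)
  finally have "sqrt_sum s \<le> 13.3 * l" .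
  moreover have "0 \<le> sqrt_sum s" using sqrt_sum_gt[OF s] a_coef_pos[OF s, of 0] by (smt (verit) real_sqrt_gt_zero)
  ultimately have "(sqrt_sum s)\<^sup>2 \<le> (13.3 * l)\<^sup>2" by (intro power_mono) auto
  also have "\<dots> = 13.3\<^sup>2 * log_term s 0" using L by (simp add: l_def power_mult_distrib power_divide)
  also have "\<dots> \<le> 178 * log_term s 0" using L by (intro mult_right_mono) (auto simp: power2_eq_square)
  finally show ?thesis .
qed

text \<open>Keeps the link deviations in the range of the Bernstein inequality. Relative to
  \<open>L_0\<close>, from level 3 on the right side is at least \<open>21 * 2 ^ k\<close>, against
  linear growth on the left; below level 3, \<open>4 ^ K \<ge> 64\<close> and
  \<open>b_k \<ge> 1.5\<close> suffice.\<close>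

lemma log_term_le_b_coef:
  assumes s: "0 < s" and K: "3 \<le> K" "k \<le> K"
  shows "64 * log_term s k \<le> 4 ^ K * b_coef k * (3 * log_term s 0)"
proof -
  have "64 * (1 + 0.4 * k) \<le> 4 ^ K * b_coef k * 3"
  proof (cases "k < 3")
    case True
    then have b: "1.5 \<le> b_coef k" by (auto simp: eval_nat_numeral less_Suc_eq b_coef_eq)
    have "(4::real) ^ 3 \<le> 4 ^ K" using K by (intro power_increasing) auto
    then have "64 * 1.5 \<le> 4 ^ K * b_coef k" using b by (intro mult_mono) auto
    then have "96 * 3 \<le> 4 ^ K * b_coef k * 3" by (simp add: mult.commute)
    moreover have "64 * (1 + 0.4 * k) \<le> 96 * (3::real)" using True by simp
    ultimately show ?thesis by linarith
  next
    case False
    then obtain i where i: "k = i + 3" by (metis add.commute le_Suc_ex not_less)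
    define z :: real where "z = 2 ^ i"
    have "real i < z" "1 \<le> z" unfolding z_def by (rule of_nat_less_two_power) simp
    then have "64 * (1 + 0.4 * k) \<le> 21 * 2 ^ k" unfolding i power_add z_def[symmetric] by (simp add: add_divide_distrib)
    also have "\<dots> = 4 ^ k * (8 / 2 ^ k * (7 / 8)) * 3"
    proof -
      have "(4::real) ^ k = 2 ^ k * 2 ^ k" by (simp flip: power_mult_distrib)
      then show ?thesis by simp
    qed
    also have "\<dots> \<le> 4 ^ K * b_coef k * 3"
    proof -
      have "(2::real) ^ 3 \<le> 2 ^ k" using False by (intro power_increasing) auto
      then have "8 / 2 ^ k * (7 / 8) \<le> b_coef k"
        using False by (simp add: b_coef_eq field_simps)
      moreover have "(4::real) ^ k \<le> 4 ^ K" using K by (intro power_increasing) auto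
      ultimately show ?thesis by (intro mult_right_mono mult_mono) auto
    qed
    finally show ?thesis .
  qed
  then have "64 * (1 + 0.4 * k) * log_term s 0 \<le> 4 ^ K * b_coef k * 3 * log_term s 0"
    using log_term_pos[OF s, of 0] by (intro mult_right_mono) auto
  then show ?thesis using log_term_le[OF s, of k] by (simp add: algebra_simps)
qed

text \<open>The exponential equals \<open>u * z ^ s\<close>, and
  \<open>sqrt (2 / pi) \<ge> 1 / 2\<close> makes \<open>u\<close> at least
  \<open>2 ^ (k + 1)\<close>.\<close>

lemma exp_log_term_ge:
  assumes s: "0 < s"
  shows "2 ^ (k + 1) * (2 * exp 1 * (2 ^ (k + 1) + 1)) ^ s \<le> exp (s * log_term s k)"
proof -
  define u where "u = C_const s * 2 ^ (k + 2) * sqrt (2 / pi)"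
  define z :: real where "z = 2 * exp 1 * (2 ^ (k + 1) + 1)"
  have z: "0 < z" by (simp add: z_def add_pos_pos)
  have "1 / 4 \<le> 2 / pi" using pi_less_4 pi_gt_zero by (simp add: field_simps)
  then have "1 / 2 \<le> sqrt (2 / pi)" by (intro real_le_rsqrt) (auto simp: power2_eq_square)
  then have "1 * 2 ^ (k + 2) * (1 / 2) \<le> u" unfolding u_def using C_const_ge_1[of s]
    by (intro mult_mono) auto
  then have u: "2 ^ (k + 1) \<le> u" by simp
  then have u0: "0 < u" by (rule less_le_trans[rotated]) simp
  have "s * log_term s k = ln u + s * ln z"
    using s by (simp add: log_term_def u_def z_def algebra_simps)
  then have "exp (s * log_term s k) = u * z ^ s"
    using u0 z by (simp add: exp_add exp_of_nat_mult)
  moreover have "2 ^ (k + 1) * z ^ s \<le> u * z ^ s" using u z by (intro mult_right_mono) auto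
  ultimately show ?thesis by (simp add: z_def)
qed

text \<open>With \<open>E = exp (s * L_k)\<close>, the exponential is \<open>1 / E\<^sup>2\<close>
  times a factor with \<open>\<alpha> - 1\<close> in place of \<open>\<alpha>\<close>. The former
  outweighs the number of links with the reserve \<open>4 * 4 ^ k * 8 ^ s\<close>, which supplies a
  geometric series in \<open>k\<close> and a factor \<open>1 / (s + 1)\<close>; the latter is at
  most \<open>(s + 1) powr (1 - \<alpha>)\<close> because \<open>E \<ge> s + 1\<close>.\<close>

lemma chain_prob_sum_le:
  assumes s: "0 < s" and \<alpha>: "1 \<le> \<alpha>"
    and c: "\<And>k. k \<le> K \<Longrightarrow> c k \<le> (exp 1 * (real (k + 1) * 2 ^ (k + 1) + 1)) ^ s"
  shows "(\<Sum>k\<le>K. c k * (2 * exp (- (2 * \<alpha> * (s * log_term s k))))) \<le> (1 / 2) * (real (s + 1)) powr (- \<alpha>)"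
proof -
  have s8: "4 / 3 * real (s + 1) \<le> 8 ^ s"
  proof -
    have "1 + real s * 7 \<le> (1 + 7) ^ s" by (rule Bernoulli_inequality) simp
    then show ?thesis using s by (simp add: field_simps)
  qed
  have term_le: "c k * (2 * exp (- (2 * \<alpha> * (s * log_term s k))))
      \<le> (3 / 4 * (1 / 4) ^ k) * ((1 / 2) * real (s + 1) powr (- \<alpha>))" if k: "k \<le> K" for k
  proof -
    define g :: real where "g = 2 ^ (k + 1)"
    have g: "real (k + 1) \<le> g" "1 \<le> g"
      unfolding g_def using of_nat_less_two_power[of "k + 1", where ?'a = real] by (auto intro: less_imp_le)
    define E where "E = exp (s * log_term s k)"
    define Z where "Z = g * (2 * exp 1 * (g + 1)) ^ s"
    have ZE: "Z \<le> E" using exp_log_term_ge[OF s, of k] by (simp add: Z_def E_def g_def)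
    have Z0: "0 < Z" using g by (auto simp: Z_def intro!: mult_pos_pos zero_less_power)
    have e2: "2 \<le> exp (1::real)" using exp_ge_add_one_self[of "1::real"] by simp
    have sZ: "real (s + 1) \<le> E"
    proof -
      have "4 * 2 \<le> (2 * exp 1) * (g + 1)" using e2 g by (intro mult_mono) auto
      then have "8 ^ s \<le> (2 * exp 1 * (g + 1)) ^ s" by (intro power_mono) auto
      then have "1 * 8 ^ s \<le> Z" unfolding Z_def using g by (intro mult_mono) auto
      then show ?thesis using ZE s8 by simp
    qed
    \<comment> \<open>The square provides a second factor \<open>g + 1\<close>, which absorbs the
      \<open>k + 1 \<le> g\<close> of the cover size; \<open>exp 1 \<ge> 2\<close> leaves the spare
      factor 8.\<close>
    have "exp 1 * (real (k + 1) * g + 1) * 8 \<le> (2 * exp 1 * (g + 1))\<^sup>2"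
    proof -
      have "real (k + 1) * g \<le> g * g" using g by (intro mult_right_mono) auto
      then have "real (k + 1) * g + 1 \<le> (g + 1)\<^sup>2" using g by (simp add: power2_eq_square algebra_simps)
      then have "(exp 1 * 4) * (2 * (real (k + 1) * g + 1)) \<le> (exp 1 * 4) * (exp 1 * (g + 1)\<^sup>2)"
        using e2 g by (intro mult_left_mono mult_mono) auto
      then show ?thesis by (simp add: power2_eq_square algebra_simps)
    qed
    then have "(exp 1 * (real (k + 1) * g + 1) * 8) ^ s \<le> ((2 * exp 1 * (g + 1))\<^sup>2) ^ s"
      using g by (intro power_mono) auto
    moreover have "c k \<le> (exp 1 * (real (k + 1) * g + 1)) ^ s" using c[OF k] by (simp add: g_def)
    then have "c k * 8 ^ s \<le> (exp 1 * (real (k + 1) * g + 1)) ^ s * 8 ^ s" by (intro mult_right_mono) auto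
    ultimately have "c k * 8 ^ s \<le> ((2 * exp 1 * (g + 1))\<^sup>2) ^ s"
      by (simp only: power_mult_distrib)
    then have "g\<^sup>2 * (c k * 8 ^ s) \<le> g\<^sup>2 * ((2 * exp 1 * (g + 1))\<^sup>2) ^ s" by (intro mult_left_mono) auto
    also have "\<dots> = Z\<^sup>2" by (simp add: Z_def power_mult_distrib[of g] flip: power_mult) (simp add: mult.commute)
    also have "\<dots> \<le> E\<^sup>2" using ZE Z0 by (intro power_mono) auto
    finally have cE: "c k * (g\<^sup>2 * 8 ^ s) \<le> E\<^sup>2" by (simp only: mult.left_commute)
    define h :: real where "h = g\<^sup>2 * 8 ^ s"
    have h: "0 < h" using g by (simp add: h_def)
    have E0: "0 < E" by (simp add: E_def)
    have "c k \<le> E\<^sup>2 / h" using cE h by (simp add: pos_le_divide_eq h_def)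
    then have "c k / E\<^sup>2 \<le> E\<^sup>2 / h / E\<^sup>2" by (intro divide_right_mono) auto
    also have "\<dots> = 1 / (g\<^sup>2 * 8 ^ s)" using E0 by (simp add: h_def)
    also have "\<dots> \<le> 1 / (g\<^sup>2 * (4 / 3 * real (s + 1)))"
      using s8 g by (intro divide_left_mono mult_left_mono mult_pos_pos) auto
    also have "\<dots> = (3 / 4 * (1 / 4) ^ k) * (1 / 4 / real (s + 1))"
    proof -
      have "g\<^sup>2 = 4 * 4 ^ k" by (simp add: g_def power2_eq_square flip: power_mult_distrib)
      then show ?thesis by (simp add: power_one_over field_simps)
    qed
    finally have cE: "c k / E\<^sup>2 \<le> (3 / 4 * (1 / 4) ^ k) * (1 / 4 / real (s + 1))" .
    have "ln (real (s + 1)) \<le> ln E" using sZ by (intro ln_mono) auto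
    then have "ln (real (s + 1)) \<le> s * log_term s k" by (simp add: E_def)
    moreover have "0 \<le> ln (real (s + 1))" by simp
    ultimately have "ln (real (s + 1)) \<le> 2 * (s * log_term s k)" by linarith
    then have "(\<alpha> - 1) * ln (real (s + 1)) \<le> (\<alpha> - 1) * (2 * (s * log_term s k))"
      using \<alpha> by (intro mult_left_mono) auto
    then have "exp (- ((\<alpha> - 1) * (2 * (s * log_term s k)))) \<le> real (s + 1) powr (- (\<alpha> - 1))"
      by (simp only: powr_def mult_minus_left exp_le_cancel_iff neg_le_iff_le) simp
    also have "\<dots> = real (s + 1) * real (s + 1) powr (- \<alpha>)"
      using powr_add[of "real (s + 1)" 1 "- \<alpha>"] by simp
    finally have pw: "exp (- ((\<alpha> - 1) * (2 * (s * log_term s k)))) \<le> real (s + 1) * real (s + 1) powr (- \<alpha>)" .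
    have "exp (- (2 * \<alpha> * x)) = exp (- ((\<alpha> - 1) * (2 * x))) / (exp x)\<^sup>2" for x
      by (simp add: algebra_simps flip: exp_double exp_diff)
    from this[of "s * log_term s k", folded E_def]
    have "exp (- (2 * \<alpha> * (s * log_term s k))) = exp (- ((\<alpha> - 1) * (2 * (s * log_term s k)))) / E\<^sup>2" .
    then have "c k * (2 * exp (- (2 * \<alpha> * (s * log_term s k))))
      = 2 * (c k / E\<^sup>2 * exp (- ((\<alpha> - 1) * (2 * (s * log_term s k)))))" by simp
    also have "\<dots> \<le> 2 * (((3 / 4 * (1 / 4) ^ k) * (1 / 4 / real (s + 1))) * (real (s + 1) * real (s + 1) powr (- \<alpha>)))"
      using cE pw by (intro mult_left_mono mult_mono) auto
    also have "\<dots> = (3 / 4 * (1 / 4) ^ k) * ((1 / 2) * real (s + 1) powr (- \<alpha>))"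
      by (simp del: of_nat_add of_nat_Suc add: field_simps)
    finally show ?thesis .
  qed
  have "(\<Sum>k\<le>K. c k * (2 * exp (- (2 * \<alpha> * (s * log_term s k)))))
      \<le> (\<Sum>k\<le>K. (3 / 4 * (1 / 4) ^ k) * ((1 / 2) * real (s + 1) powr (- \<alpha>)))"
    using term_le by (intro sum_mono) auto
  also have "\<dots> = (3 / 4 * (\<Sum>k\<le>K. (1 / 4) ^ k)) * ((1 / 2) * real (s + 1) powr (- \<alpha>))"
    by (simp only: sum_distrib_left[symmetric] sum_distrib_right[symmetric])
  also have "\<dots> \<le> 1 * ((1 / 2) * real (s + 1) powr (- \<alpha>))"
  proof (rule mult_right_mono)
    have "(\<Sum>k\<le>K. (1 / 4) ^ k) = (1 - (1 / 4 :: real) ^ Suc K) / (1 - 1 / 4)" by (simp add: sum_gp0)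
    also have "\<dots> \<le> 4 / 3" by (simp add: field_simps)
    finally show "3 / 4 * (\<Sum>k\<le>K. (1 / 4) ^ k) \<le> (1::real)" by simp
  qed auto
  finally show ?thesis by simp
qed

text \<open>The sum starts at base 2, matching \<open>s + 1\<close> for \<open>s \<ge> 1\<close> and
  \<open>m\<close> for \<open>m \<ge> 2\<close>.\<close>

lemma zeta_real_minus_1:
  assumes "1 < a"
  shows "(\<lambda>n. real (n + 2) powr (- a)) sums (zeta_real a - 1)" and "0 < zeta_real a - 1"
proof -
  have "summable (\<lambda>n. real n powr (- a))" using assms by (simp add: summable_real_powr_iff)
  then have "summable (\<lambda>n. real (Suc n) powr (- a))" by (subst summable_Suc_iff)
  then have "(\<lambda>n. real (Suc n) powr (- a)) sums zeta_real a"
    unfolding zeta_real_def by (simp add: powr_minus inverse_eq_divide summable_sums)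
  then have "(\<lambda>n. real (Suc (Suc n)) powr (- a)) sums (zeta_real a - real (Suc 0) powr (- a))"
    by (subst sums_Suc_iff) simp
  then show *: "(\<lambda>n. real (n + 2) powr (- a)) sums (zeta_real a - 1)" by (simp add: add.commute)
  show "0 < zeta_real a - 1"
    using suminf_pos[OF sums_summable[OF *]] sums_unique[OF *] by simp
qed

section \<open>Numerical evaluation of \<open>A_2\<close>\<close>

lemma ln_pi_ge: "1.14472 \<le> ln pi"
proof -
  have "1.14472 \<le> ln (3.14159 :: real)" using ln_approx_bounds[of "3.14159" 8] by (simp add: eval_nat_numeral)
  also have "\<dots> \<le> ln pi" using pi_approx by simp
  finally show ?thesis .
qed

text \<open>For \<open>s = 2\<close> the factor \<open>C_2\<close> is 1 and \<open>L_k\<close> is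
  \<open>1 + 3.25 * ln 2 - ln pi / 4 + 1.5 * k * ln 2\<close> plus a last logarithm, kept apart to
  be estimated level by level.\<close>

lemma log_term_2_le:
  assumes "ln (1 + 1 / 2 ^ (k + 1)) \<le> (x::real)"
  shows "log_term 2 k \<le> 2.966551 + 1.039722 * k + x"
proof -
  have "C_const 2 = 1"
  proof -
    have "1.1 powr (real 2 - 101) \<le> 1.1 powr 0" by (intro powr_mono) auto
    then show ?thesis by (simp add: C_const_def)
  qed
  moreover have "ln (4 * sqrt (2 / pi)) = 2 * ln 2 + (ln 2 - ln pi) / 2"
  proof -
    have "ln (4::real) = 2 * ln 2" using ln_realpow[of 2 2] by simp
    then show ?thesis using pi_gt_zero by (simp add: ln_mult_pos ln_sqrt ln_div)
  qed
  moreover have "ln ((2::real) ^ (k + 1) + 1) = (k + 1) * ln 2 + ln (1 + 1 / 2 ^ (k + 1))"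
  proof -
    have "(2::real) ^ (k + 1) + 1 = 2 ^ (k + 1) * (1 + 1 / 2 ^ (k + 1))" by (simp add: field_simps)
    moreover have "0 < 1 + 1 / (2::real) ^ (k + 1)" by (simp add: add_pos_pos)
    ultimately show ?thesis by (simp only: ln_mult_pos zero_less_power zero_less_numeral ln_realpow)
  qed
  ultimately have "log_term 2 k = 1 + 3.25 * ln 2 - ln pi / 4 + k * (1.5 * ln 2) + ln (1 + 1 / 2 ^ (k + 1))"
    unfolding log_term_expand by (simp add: field_simps)
  moreover have "k * (1.5 * ln 2) \<le> k * (1.039722::real)" using ln_2_le by (intro mult_left_mono) auto
  ultimately show ?thesis using assms ln_2_le ln_pi_ge by simp
qed

lemma A_const_2_le: "A_const 2 \<le> 942"
proof -
  \<comment> \<open>Upper bounds of \<open>sqrt (a_coef 2 k)\<close> for \<open>k < 20\<close>. The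
    many digits are forced: the resulting bound 21.7025 on \<open>S\<close> gives
    \<open>2 * 21.7025\<^sup>2\<close>, which is within 0.003 of 942.\<close>
  define rs :: "real list" where "rs = [3.18058, 2.90841, 2.78311, 2.31907, 1.83159, 1.40759,
    1.06471, 0.7972, 0.59273, 0.43841, 0.32297, 0.23715, 0.17366, 0.12687, 0.0925, 0.06732,
    0.04892, 0.0355, 0.02573, 0.01862]"
  \<comment> \<open>Four logarithms are estimated closely, the others by
    \<open>ln (1 + x) \<le> x\<close>.\<close>
  define lam :: "nat \<Rightarrow> real" where
    "lam k = (if k < 4 then [0.405466, 0.223144, 0.117784, 0.060625] ! k else 1 / 2 ^ (k + 1))" for k
  have lam: "ln (1 + 1 / 2 ^ (k + 1)) \<le> lam k" for k
  proof (cases "k < 4")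
    case True
    have "ln (1 + 1 / 2) \<le> (0.405466::real)" "ln (1 + 1 / 4) \<le> (0.223144::real)"
      "ln (1 + 1 / 8) \<le> (0.117784::real)" "ln (1 + 1 / 16) \<le> (0.060625::real)"
      using ln_approx_bounds[of "3/2" 4] ln_approx_bounds[of "5/4" 4] ln_approx_bounds[of "9/8" 3] ln_approx_bounds[of "17/16" 3]
      by (simp_all add: eval_nat_numeral)
    then show ?thesis using True by (auto simp: lam_def eval_nat_numeral less_Suc_eq)
  qed (auto simp: lam_def intro: ln_add_one_self_le_self)
  have up: "sqrt (a_coef 2 k) \<le> rs ! k" if "k < 20" for k
  proof (rule sqrt_le_of_sq)
    have "b_coef k * (2.966551 + 1.039722 * k + lam k) \<le> rs ! k * rs ! k \<and> 0 \<le> rs ! k"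
      using that by (auto simp: eval_nat_numeral less_Suc_eq b_coef_eq rs_def lam_def)
    moreover have "a_coef 2 k \<le> b_coef k * (2.966551 + 1.039722 * k + lam k)"
      unfolding a_coef_eq using b_coef_pos[of k] by (intro mult_left_mono log_term_2_le lam) auto
    ultimately show "a_coef 2 k \<le> rs ! k * rs ! k" "0 \<le> rs ! k" by auto
  qed
  \<comment> \<open>The bound on \<open>L_k\<close> at \<open>k = j + 20\<close> is
    \<open>23.760992 + 1.039722 * j\<close>; \<open>c\<close> is taken with
    \<open>c\<^sup>2 * 2 ^ 17\<close> just above the constant, and \<open>d\<close> just above half
    the ratio of slope to constant.\<close>
  have tail: "(\<Sum>j. sqrt (a_coef 2 (j + 20))) \<le> 0.01347 * ((1 - 0.02188) * 3.41422 + 0.02188 * 11.6569)"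
  proof (rule sqrt_tail_sum(2))
    fix j :: nat
    have lj: "lam (j + 20) \<le> 0.000001"
    proof -
      have "lam (j + 20) = 1 / 2 ^ j * (1 / 2 ^ 21)" by (simp add: lam_def power_add)
      also have "\<dots> \<le> 1 * (1 / 2 ^ 21)" by (intro mult_right_mono) auto
      finally have "lam (j + 20) \<le> 1 / 2 ^ 21" by simp
      then show ?thesis by simp
    qed
    have "a_coef 2 (j + 20) \<le> 8 / 2 ^ (j + 20) * (2.966551 + 1.039722 * real (j + 20) + lam (j + 20))"
      unfolding a_coef_eq using b_coef_le[of "j + 20"] log_term_2_le[OF lam, of "j + 20"] log_term_pos[of 2 "j + 20"] b_coef_pos[of "j + 20"]
      by (intro mult_mono) auto
    also have "\<dots> \<le> 8 / 2 ^ (j + 20) * (23.760992 + 1.039722 * j)"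
      using lj by (intro mult_left_mono) (auto simp: add_divide_distrib)
    also have "\<dots> \<le> 8 / 2 ^ (j + 20) * ((0.01347\<^sup>2 * 2 ^ 17) * (1 + 2 * 0.02188 * j))"
    proof (intro mult_left_mono)
      show "23.760992 + 1.039722 * real j \<le> (0.01347\<^sup>2 * 2 ^ 17) * (1 + 2 * 0.02188 * real j)"
        by (simp add: power2_eq_square algebra_simps add_mono mult_right_mono)
    qed auto
    also have "\<dots> = 0.01347\<^sup>2 * (1 + 2 * 0.02188 * j) / 2 ^ j" by (simp add: power_add field_simps)
    finally show "a_coef 2 (j + 20) \<le> 0.01347\<^sup>2 * (1 + 2 * 0.02188 * j) / 2 ^ j" .
  qed (use a_coef_pos[of 2] in \<open>auto intro: less_imp_le\<close>)
  have "sqrt_sum 2 \<le> rs ! 0 + (\<Sum>k<20. rs ! k) + 0.01347 * ((1 - 0.02188) * 3.41422 + 0.02188 * 11.6569)"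
    by (rule sqrt_sum_le_split[OF _ tail up]) auto
  also have "\<dots> \<le> 21.7025" by (simp add: rs_def eval_nat_numeral)
  finally have "sqrt_sum 2 \<le> 21.7025" .
  moreover have "0 \<le> sqrt_sum 2" using sqrt_sum_gt[of 2] a_coef_pos[of 2 0] by (smt (verit) real_sqrt_gt_zero zero_less_numeral)
  ultimately have "(sqrt_sum 2)\<^sup>2 \<le> 21.7025\<^sup>2" by (intro power_mono) auto
  then show ?thesis unfolding A_const_eq by (simp add: power2_eq_square)
qed

section \<open>Discrepancy of a random matrix\<close>

lemma of_bool_Ball_eq_prod:
  "finite A \<Longrightarrow> of_bool (\<forall>i\<in>A. P i) = (\<Prod>i\<in>A. of_bool (P i) :: real)"
  by (induction A rule: finite_induct) auto

text \<open>As \<open>A_s = 2 * S\<^sup>2\<close>, the square of \<open>S * \<tau>\<close> is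
  \<open>s * \<alpha> * A_s + 178 * \<beta> * ln m\<close>, and
  \<open>m \<le> log 2 N\<close>.\<close>

lemma claimed_bound_ge:
  fixes \<alpha> \<beta> \<tau> :: real and s m N :: nat
  assumes s: "0 < s" and m: "1 \<le> m" and N: "2 ^ m \<le> N" and \<alpha>: "0 \<le> \<alpha>" and \<beta>: "0 \<le> \<beta>"
    and \<tau>: "\<tau>\<^sup>2 = 2 * \<alpha> * s + \<beta> * 178 * ln m / (sqrt_sum s)\<^sup>2"
  shows "sqrt_sum s * \<tau> / sqrt N \<le> sqrt (\<alpha> * A_const s + \<beta> * 178 * ln (log 2 N) / s) * sqrt (s / N)"
proof -
  have S: "0 < sqrt_sum s" using sqrt_sum_gt[OF s] a_coef_pos[OF s, of 0] by (smt (verit) real_sqrt_gt_zero)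
  have N0: "0 < real N" using N by (metis not_gr0 not_le of_nat_0_less_iff zero_less_numeral zero_less_power)
  have "real (2 ^ m) \<le> real N" using N by (rule of_nat_mono)
  then have "log 2 (2 ^ m) \<le> log 2 N" by (intro log_mono) auto
  then have "real m \<le> log 2 N" by simp
  then have "ln m \<le> ln (log 2 N)" using m by (intro ln_mono) auto
  then have ln: "\<beta> * 178 * ln m \<le> \<beta> * 178 * ln (log 2 N)" using \<beta> by (intro mult_left_mono) auto
  have "(sqrt_sum s * \<tau>)\<^sup>2 = s * (\<alpha> * A_const s) + \<beta> * 178 * ln m"
    unfolding power_mult_distrib \<tau> A_const_eq using S by (simp add: algebra_simps)
  also have "\<dots> \<le> s * (\<alpha> * A_const s) + \<beta> * 178 * ln (log 2 N)" using ln by simp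
  also have "\<dots> = (\<alpha> * A_const s + \<beta> * 178 * ln (log 2 N) / s) * s" using s by (simp add: field_simps)
  finally have "sqrt_sum s * \<tau> \<le> sqrt ((\<alpha> * A_const s + \<beta> * 178 * ln (log 2 N) / s) * s)"
    by (rule real_le_rsqrt)
  then have "sqrt_sum s * \<tau> / sqrt N \<le> sqrt ((\<alpha> * A_const s + \<beta> * 178 * ln (log 2 N) / s) * s) / sqrt N"
    by (intro divide_right_mono) auto
  also have "\<dots> = sqrt (\<alpha> * A_const s + \<beta> * 178 * ln (log 2 N) / s) * sqrt (s / N)"
    by (simp only: real_sqrt_mult real_sqrt_divide times_divide_eq_right)
  finally show ?thesis .
qed

text \<open>Reduces the supremum to countably many boxes, for measurability. Corners are approached
  from below: boxes are half-open, so each inequality \<open>x k i < y i\<close> survives near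
  \<open>y\<close>, the counts eventually agree, and only the volume varies.\<close>

lemma box_deviation_rational_approx:
  assumes y: "y \<in> unit_cube {1..s}"
    and le: "\<And>z. z \<in> PiE {1..s} (\<lambda>_. \<rat> \<inter> {0..1}) \<Longrightarrow> \<bar>box_deviation s N x z\<bar> \<le> c"
  shows "\<bar>box_deviation s N x y\<bar> \<le> c"
proof -
  have "\<exists>f. (\<forall>n. f n \<in> \<rat> \<inter> {0..1} \<and> f n \<le> u) \<and> f \<longlonglongrightarrow> u" if u: "0 \<le> u" "u \<le> 1" for u :: real
  proof (cases "u = 0")
    case True
    then show ?thesis by (intro exI[of _ "\<lambda>_. 0"]) auto
  next
    case False
    have "\<forall>n. \<exists>q. q \<in> \<rat> \<and> max 0 (u - 1 / real (Suc n)) < q \<and> q < u"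
    proof
      fix n
      have "max 0 (u - 1 / real (Suc n)) < u" using False u by simp
      from Rats_dense_in_real[OF this] show "\<exists>q. q \<in> \<rat> \<and> max 0 (u - 1 / real (Suc n)) < q \<and> q < u" by blast
    qed
    from choice[OF this] obtain f where f: "f n \<in> \<rat>" "max 0 (u - 1 / real (Suc n)) < f n" "f n < u" for n by blast
    have "f \<longlonglongrightarrow> u"
    proof (rule tendsto_sandwich)
      show "(\<lambda>n. u - 1 / real (Suc n)) \<longlonglongrightarrow> u"
        using tendsto_diff[OF tendsto_const[of u] LIMSEQ_inverse_real_of_nat] by (simp add: inverse_eq_divide)
      show "(\<lambda>n. u) \<longlonglongrightarrow> u" by simp
    qed (use f in \<open>auto intro!: always_eventually less_imp_le\<close>)
    moreover have "f n \<in> \<rat> \<inter> {0..1} \<and> f n \<le> u" for n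
      using f(1)[of n] f(2)[of n] f(3)[of n] u by auto
    ultimately show ?thesis by blast
  qed
  then have "\<forall>i. \<exists>f. i \<in> {1..s} \<longrightarrow> (\<forall>n. f n \<in> \<rat> \<inter> {0..1} \<and> f n \<le> y i) \<and> f \<longlonglongrightarrow> y i"
    using y by (auto simp: PiE_iff)
  then obtain f where f: "\<And>i n. i \<in> {1..s} \<Longrightarrow> f i n \<in> \<rat> \<inter> {0..1} \<and> f i n \<le> y i"
    and lim: "\<And>i. i \<in> {1..s} \<Longrightarrow> f i \<longlonglongrightarrow> y i" by metis
  define z where "z n = (\<lambda>i\<in>{1..s}. f i n)" for n
  have z: "z n \<in> PiE {1..s} (\<lambda>_. \<rat> \<inter> {0..1})" for n
    using f unfolding z_def by (intro restrict_PiE_iff[THEN iffD2] ballI) blast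
  have ev: "\<forall>\<^sub>F n in sequentially. \<forall>k\<in>{1..N}. \<forall>i\<in>{1..s}. x k i < y i \<longrightarrow> x k i < z n i"
  proof (intro eventually_ball_finite ballI)
    fix k i assume i: "i \<in> {1..s}"
    show "\<forall>\<^sub>F n in sequentially. x k i < y i \<longrightarrow> x k i < z n i"
    proof (cases "x k i < y i")
      case True
      from order_tendstoD(1)[OF lim[OF i] True] show ?thesis
        by eventually_elim (use i in \<open>simp add: z_def\<close>)
    qed simp
  qed auto
  have zy: "z n i \<le> y i" if "i \<in> {1..s}" for n i using f that by (simp add: z_def)
  define V where "V w = (\<Prod>i\<in>{1..s}. w i)" for w :: "nat \<Rightarrow> real"
  define h where "h = real (card {k \<in> {1..N}. \<forall>i\<in>{1..s}. 0 \<le> x k i \<and> x k i < y i})"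
  have "\<forall>\<^sub>F n in sequentially. box_deviation s N x (z n) = h - N * V (z n)"
    using ev
  proof eventually_elim
    case (elim n)
    have "{k \<in> {1..N}. \<forall>i\<in>{1..s}. 0 \<le> x k i \<and> x k i < z n i} = {k \<in> {1..N}. \<forall>i\<in>{1..s}. 0 \<le> x k i \<and> x k i < y i}"
      using elim zy[of _ n] by (blast intro: less_le_trans)
    then show ?case by (simp only: box_deviation_def V_def h_def)
  qed
  moreover have "(\<lambda>n. h - N * V (z n)) \<longlonglongrightarrow> h - N * V y"
  proof -
    have "(\<lambda>n. V (z n)) \<longlonglongrightarrow> V y"
      unfolding V_def using lim by (intro tendsto_prod) (simp add: z_def)
    then show ?thesis by (intro tendsto_intros)
  qed
  ultimately have "(\<lambda>n. box_deviation s N x (z n)) \<longlonglongrightarrow> h - N * V y"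
    by (subst tendsto_cong) auto
  then have "(\<lambda>n. \<bar>box_deviation s N x (z n)\<bar>) \<longlonglongrightarrow> \<bar>box_deviation s N x y\<bar>"
    unfolding box_deviation_def[of s N x y] h_def V_def by (rule tendsto_rabs)
  then show ?thesis by (rule LIMSEQ_le_const2) (use le[OF z] in blast)
qed

section \<open>Link events and discrepancy events of the uniform matrix\<close>

locale uniform_matrix = prob_space M for M :: "'a measure" +
  fixes X :: "nat \<Rightarrow> nat \<Rightarrow> 'a \<Rightarrow> real"
  assumes indep: "indep_vars (\<lambda>_. borel) (\<lambda>(n, j). X n j) {(n, j). 1 \<le> n \<and> 1 \<le> j}"
    and unif: "\<And>n j. 1 \<le> n \<Longrightarrow> 1 \<le> j \<Longrightarrow> distr M borel (X n j) = uniform_measure lborel {0..<1}"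
begin

lemma rv [measurable]: "1 \<le> n \<Longrightarrow> 1 \<le> j \<Longrightarrow> random_variable borel (X n j)"
  using indep by (force simp: indep_vars_def)

lemma prob_interval:
  assumes "1 \<le> n" "1 \<le> i" "0 \<le> u" "u \<le> 1"
  shows "prob (X n i -` {0..<u} \<inter> space M) = u"
proof -
  have "prob (X n i -` {0..<u} \<inter> space M) = measure (distr M borel (X n i)) {0..<u}"
    using assms by (subst measure_distr) auto
  also have "\<dots> = measure lborel ({0..<1} \<inter> {0..<u}) / measure lborel {0..<1::real}"
    unfolding unif[OF assms(1,2)] by (rule measure_uniform_measure) auto
  also have "{0..<1} \<inter> {0..<u} = {0..<u}" using assms by auto
  finally show ?thesis using assms by simp
qed

lemma box_event [measurable]:
  assumes "1 \<le> n"
  shows "{\<omega> \<in> space M. \<forall>i\<in>{1..s}. 0 \<le> X n i \<omega> \<and> X n i \<omega> < y i} \<in> events"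
proof -
  have "{\<omega> \<in> space M. 0 \<le> X n i \<omega> \<and> X n i \<omega> < y i} \<in> events" if "i \<in> {1..s}" for i
  proof -
    have "X n i -` {0..<y i} \<inter> space M \<in> events"
      using assms that by (intro measurable_sets[OF rv]) auto
    also have "X n i -` {0..<y i} \<inter> space M = {\<omega> \<in> space M. 0 \<le> X n i \<omega> \<and> X n i \<omega> < y i}" by auto
    finally show ?thesis .
  qed
  then show ?thesis by (intro sets.sets_Collect_finite_All) auto
qed

lemma prob_box:
  assumes n: "1 \<le> n" and s: "0 < s" and y: "y \<in> unit_cube {1..s}"
  shows "prob {\<omega> \<in> space M. \<forall>i\<in>{1..s}. 0 \<le> X n i \<omega> \<and> X n i \<omega> < y i} = (\<Prod>i\<in>{1..s}. y i)"
proof -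
  have "indep_vars (\<lambda>_. borel) (\<lambda>(n, j). X n j) (Pair n ` {1..s})"
    using n by (intro indep_vars_subset[OF indep]) auto
  then have "prob (\<Inter>q\<in>Pair n ` {1..s}. (\<lambda>(n, j). X n j) q -` (\<lambda>(n, i). {0..<y i}) q \<inter> space M)
      = (\<Prod>q\<in>Pair n ` {1..s}. prob ((\<lambda>(n, j). X n j) q -` (\<lambda>(n, i). {0..<y i}) q \<inter> space M))"
    by (rule indep_varsD_finite) (use s in auto)
  then have "prob (\<Inter>i\<in>{1..s}. X n i -` {0..<y i} \<inter> space M) = (\<Prod>i\<in>{1..s}. prob (X n i -` {0..<y i} \<inter> space M))"
    using s by (simp add: prod.reindex inj_on_def)
  also have "\<dots> = (\<Prod>i\<in>{1..s}. y i)"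
    using n y by (intro prod.cong prob_interval refl) (auto simp: PiE_iff)
  also have "(\<Inter>i\<in>{1..s}. X n i -` {0..<y i} \<inter> space M)
      = {\<omega> \<in> space M. \<forall>i\<in>{1..s}. 0 \<le> X n i \<omega> \<and> X n i \<omega> < y i}"
    using s by force
  finally show ?thesis .
qed

text \<open>As \<open>v \<le> w\<close>, the indicators of the two boxes differ by a 0-1 variable
  whose mean is the difference of volumes, so its variance is at most \<open>b_coef k / 8\<close>
  and the maximal Bernstein inequality applies.\<close>

lemma prob_link_le:
  fixes n :: nat
  assumes s: "0 < s" and v: "v \<in> unit_cube {1..s}" and w: "w \<in> unit_cube {1..s}"
    and vw: "\<forall>i\<in>{1..s}. v i \<le> w i" and vol: "(\<Prod>i\<in>{1..s}. w i) - (\<Prod>i\<in>{1..s}. v i) \<le> 1 / 2 ^ k"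
    and n: "0 < n" and t: "0 \<le> t" "t \<le> 2 * real n * (b_coef k / 8)"
  shows "prob {\<omega> \<in> space M. \<exists>N\<le>n. t < \<bar>box_deviation s N (\<lambda>n j. X n j \<omega>) w - box_deviation s N (\<lambda>n j. X n j \<omega>) v\<bar>}
      \<le> 2 * exp (- (t\<^sup>2 / (4 * real n * (b_coef k / 8))))"
proof -
  define p where "p = (\<Prod>i\<in>{1..s}. w i) - (\<Prod>i\<in>{1..s}. v i)"
  define I where "I y f = (of_bool (\<forall>i\<in>{1..s}. 0 \<le> f i \<and> f i < y i) :: real)" for y f :: "nat \<Rightarrow> real"
  define Y where "Y i \<omega> = I w (\<lambda>j. X (Suc i) j \<omega>) - I v (\<lambda>j. X (Suc i) j \<omega>)" for i \<omega>
  have Im: "(\<lambda>f. I y (\<lambda>j. f (Suc i, j))) \<in> borel_measurable (PiM ({Suc i} \<times> {1..s}) (\<lambda>_. borel))" for y i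
  proof -
    have "I y f = (\<Prod>j\<in>{1..s}. indicator {0..<y j} (f j))" for f
      unfolding I_def by (subst of_bool_Ball_eq_prod) (auto intro!: prod.cong simp: indicator_def)
    moreover have "(\<lambda>f. \<Prod>j\<in>{1..s}. indicator {0..<y j} (f (Suc i, j)) :: real)
        \<in> borel_measurable (PiM ({Suc i} \<times> {1..s}) (\<lambda>_. borel))"
    proof (rule borel_measurable_prod)
      fix j assume "j \<in> {1..s}"
      then have "(\<lambda>f. f (Suc i, j)) \<in> borel_measurable (PiM ({Suc i} \<times> {1..s}) (\<lambda>_. borel :: real measure))"
        by (intro measurable_component_singleton) auto
      then show "(\<lambda>f. indicator {0..<y j} (f (Suc i, j)) :: real) \<in> borel_measurable (PiM ({Suc i} \<times> {1..s}) (\<lambda>_. borel))"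
        by measurable
    qed
    ultimately show ?thesis by simp
  qed
  \<comment> \<open>Distinct rows use disjoint index sets, so functions of whole rows inherit
    independence. Index \<open>i\<close> stands for row \<open>Suc i\<close>.\<close>
  have "indep_vars (\<lambda>i. PiM ({Suc i} \<times> {1..s}) (\<lambda>_. borel))
      (\<lambda>i \<omega>. restrict (\<lambda>q. (case q of (n, j) \<Rightarrow> X n j) \<omega>) ({Suc i} \<times> {1..s})) {..<n}"
    by (rule indep_vars_restrict[OF indep]) (auto simp: disjoint_family_on_def)
  then have "indep_vars (\<lambda>_. borel) (\<lambda>i \<omega>. (\<lambda>f. I w (\<lambda>j. f (Suc i, j)) - I v (\<lambda>j. f (Suc i, j)))
      (restrict (\<lambda>q. (case q of (n, j) \<Rightarrow> X n j) \<omega>) ({Suc i} \<times> {1..s}))) {..<n}"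
    by (rule indep_vars_compose2) (intro borel_measurable_diff Im)
  then have ind: "indep_vars (\<lambda>_. borel) Y {..<n}"
    by (rule indep_vars_cong[THEN iffD1, rotated -1]) (auto simp: Y_def I_def fun_eq_iff)
  have expI: "integrable M (\<lambda>\<omega>. I y (\<lambda>j. X (Suc i) j \<omega>)) \<and>
      expectation (\<lambda>\<omega>. I y (\<lambda>j. X (Suc i) j \<omega>)) = (\<Prod>i\<in>{1..s}. y i)" if "y \<in> unit_cube {1..s}" for y i
  proof -
    let ?E = "{\<omega> \<in> space M. \<forall>j\<in>{1..s}. 0 \<le> X (Suc i) j \<omega> \<and> X (Suc i) j \<omega> < y j}"
    have E: "?E \<in> events" by (rule box_event) simp
    have "integrable M (\<lambda>\<omega>. I y (\<lambda>j. X (Suc i) j \<omega>)) \<longleftrightarrow> integrable M (indicator ?E :: _ \<Rightarrow> real)"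
      by (rule Bochner_Integration.integrable_cong) (auto simp: I_def indicator_def)
    moreover have "expectation (\<lambda>\<omega>. I y (\<lambda>j. X (Suc i) j \<omega>)) = expectation (indicator ?E)"
      by (rule Bochner_Integration.integral_cong) (auto simp: I_def indicator_def)
    moreover have "prob ?E = (\<Prod>i\<in>{1..s}. y i)" using s that by (intro prob_box) auto
    ultimately show ?thesis using E by (simp add: emeasure_eq_measure)
  qed
  have ex: "expectation (Y i) = p" for i
    unfolding Y_def p_def using expI[OF v] expI[OF w] by simp
  have Y01: "Y i \<omega> \<in> {0, 1}" for i \<omega>
    using vw by (auto simp: Y_def I_def intro: less_le_trans)
  have "0 \<le> p" unfolding p_def using vw v by (auto simp: PiE_iff intro!: prod_mono)
  then have pv: "p * (1 - p) \<le> b_coef k / 8"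
    using vol unfolding p_def by (rule bernoulli_variance_le_b_coef)
  have dev: "box_deviation s N (\<lambda>n j. X n j \<omega>) w - box_deviation s N (\<lambda>n j. X n j \<omega>) v = (\<Sum>i<N. Y i \<omega> - p)" for N \<omega>
    unfolding box_deviation_eq_sum Y_def I_def p_def sum_subtractf[symmetric] by (intro sum.cong refl) simp
  show ?thesis unfolding dev
    using b_coef_pos[of k] n t by (intro bernoulli_maximal_bernstein[OF ind Y01 ex pv]) auto
qed

lemma box_deviation_measurable [measurable]:
  "(\<lambda>\<omega>. box_deviation s N (\<lambda>n j. X n j \<omega>) y) \<in> borel_measurable M"
proof -
  have "(\<lambda>\<omega>. of_bool (\<forall>i\<in>{1..s}. 0 \<le> X (Suc n) i \<omega> \<and> X (Suc n) i \<omega> < y i) :: real) \<in> borel_measurable M" for n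
  proof -
    have "(indicator {\<omega> \<in> space M. \<forall>i\<in>{1..s}. 0 \<le> X (Suc n) i \<omega> \<and> X (Suc n) i \<omega> < y i} :: 'a \<Rightarrow> real) \<in> borel_measurable M"
      by (intro borel_measurable_indicator box_event) simp
    then show ?thesis by (rule measurable_cong[THEN iffD1, rotated]) (auto simp: indicator_def)
  qed
  then show ?thesis unfolding box_deviation_eq_sum by measurable
qed

lemma star_discrepancy_event:
  assumes "0 < N"
  shows "{\<omega> \<in> space M. star_discrepancy s N (\<lambda>n j. X n j \<omega>) \<le> c} \<in> events"
proof -
  let ?Q = "PiE {1..s} (\<lambda>_. \<rat> \<inter> {0..1::real})"
  have sub: "?Q \<subseteq> unit_cube {1..s}" by (intro PiE_mono) auto
  have "star_discrepancy s N x \<le> c \<longleftrightarrow> (\<forall>y\<in>?Q. \<bar>box_deviation s N x y\<bar> \<le> c * N)" for x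
  proof
    assume "star_discrepancy s N x \<le> c"
    then show "\<forall>y\<in>?Q. \<bar>box_deviation s N x y\<bar> \<le> c * N"
      unfolding star_discrepancy_le_iff[OF assms] by (intro ballI) (erule bspec, erule subsetD[OF sub])
  next
    assume Q: "\<forall>y\<in>?Q. \<bar>box_deviation s N x y\<bar> \<le> c * N"
    show "star_discrepancy s N x \<le> c" unfolding star_discrepancy_le_iff[OF assms]
    proof
      fix y assume "y \<in> unit_cube {1..s}"
      then show "\<bar>box_deviation s N x y\<bar> \<le> c * N"
        by (rule box_deviation_rational_approx) (erule bspec[OF Q])
    qed
  qed
  moreover have "{\<omega> \<in> space M. \<forall>y\<in>?Q. \<bar>box_deviation s N (\<lambda>n j. X n j \<omega>) y\<bar> \<le> c * N} \<in> events"
    by (intro sets.sets_Collect_countable_All' countable_PiE) (auto simp: countable_rat)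
  ultimately show ?thesis by simp
qed

text \<open>One exceptional event serves all \<open>N\<close> of a dyadic block. For
  \<open>m = 1\<close> it has probability 0, since the trivial bound suffices there; so only blocks
  with \<open>m \<ge> 2\<close> contribute to the total.\<close>

lemma star_discrepancy_block:
  fixes s m :: nat and \<alpha> \<beta> :: real
  assumes s: "0 < s" and m: "1 \<le> m" and \<alpha>: "1 \<le> \<alpha>" and \<beta>: "0 \<le> \<beta>"
  obtains E where "E \<in> events"
    and "prob E \<le> (if m = 1 then 0 else 1 / 2 * real (s + 1) powr (- \<alpha>) * real m powr (- \<beta>))"
    and "\<And>\<omega> N. \<omega> \<in> space M - E \<Longrightarrow> 2 ^ m \<le> N \<Longrightarrow> N < 2 ^ (m + 1) \<Longrightarrow>
      star_discrepancy s N (\<lambda>n j. X n j \<omega>)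
        \<le> sqrt (\<alpha> * A_const s + \<beta> * 178 * ln (log 2 N) / s) * sqrt (s / N)"
proof -
  define S where "S = sqrt_sum s"
  define r where "r = sqrt (a_coef s 0)"
  have r: "0 < r" using a_coef_pos[OF s, of 0] by (simp add: r_def)
  have rS: "4 * r < S" using sqrt_sum_gt[OF s] by (simp add: r_def S_def)
  have S: "0 < S" using r rS by linarith
  define L where "L = log_term s"
  have L: "0 < L k" for k using log_term_pos[OF s] by (simp add: L_def)
  define \<tau> where "\<tau> = sqrt (2 * \<alpha> * s + \<beta> * 178 * ln m / S\<^sup>2)"
  have lnm: "0 \<le> ln (real m)" using m by simp
  have arg: "0 \<le> \<beta> * 178 * ln m / S\<^sup>2" using \<beta> lnm by simp
  have "0 < 2 * \<alpha> * s" using \<alpha> s by simp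
  then have \<tau>2: "\<tau>\<^sup>2 = 2 * \<alpha> * s + \<beta> * 178 * ln m / S\<^sup>2" and \<tau>: "0 < \<tau>"
    using arg unfolding \<tau>_def by simp_all
  define Q :: real where "Q = sqrt (2 ^ m)"
  have Q: "0 < Q" "Q\<^sup>2 = 2 ^ m" by (simp_all add: Q_def)
  have NQ: "Q \<le> sqrt N" "sqrt N < 2 * Q" "0 < N" if "2 ^ m \<le> N" "N < 2 ^ (m + 1)" for N :: nat
  proof -
    have "real (2 ^ m) \<le> N" by (rule of_nat_mono[OF that(1)])
    then show "Q \<le> sqrt N" unfolding Q_def by simp
    have "real N < real (2 ^ (m + 1))" using that by (simp only: of_nat_less_iff)
    then have "real N < 4 * Q\<^sup>2" using Q by simp
    then show "sqrt N < 2 * Q" using Q(1) by (intro real_less_lsqrt) (simp_all add: power_mult_distrib)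
    show "0 < N" using that by (metis not_gr0 not_le zero_less_numeral zero_less_power)
  qed
  have target: "S * \<tau> / sqrt N \<le> sqrt (\<alpha> * A_const s + \<beta> * 178 * ln (log 2 N) / s) * sqrt (s / N)"
    if "2 ^ m \<le> N" for N :: nat
    unfolding S_def using \<alpha> \<beta> \<tau>2 s m that by (intro claimed_bound_ge) (auto simp: S_def)
  show thesis
  \<comment> \<open>As \<open>sqrt N < 2 * Q\<close> in the block,
    \<open>2 * Q \<le> S * \<tau>\<close> makes the claimed bound at least 1, and the empty event
    will do.\<close>
  proof (cases "2 * Q \<le> S * \<tau>")
    case True
    have "star_discrepancy s N (\<lambda>n j. X n j \<omega>)
        \<le> sqrt (\<alpha> * A_const s + \<beta> * 178 * ln (log 2 N) / s) * sqrt (s / N)"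
      if N: "2 ^ m \<le> N" "N < 2 ^ (m + 1)" for \<omega> N
    proof -
      have "star_discrepancy s N (\<lambda>n j. X n j \<omega>) \<le> 1"
        using NQ(3)[OF N] abs_box_deviation_le by (subst star_discrepancy_le_iff) auto
      also have "1 \<le> S * \<tau> / sqrt N" using True NQ[OF N] by (simp add: pos_le_divide_eq)
      also note target[OF N(1)]
      finally show ?thesis .
    qed
    then show thesis by (intro that[of "{}"]) auto
  next
    case False
    \<comment> \<open>For \<open>m = 1\<close>, \<open>Q\<close> is \<open>sqrt 2\<close>, while
      \<open>S \<ge> 4\<close> and \<open>\<tau> \<ge> sqrt 2\<close> put \<open>S * \<tau>\<close>
      above \<open>2 * Q\<close>.\<close>
    have "m \<noteq> 1"
    proof
      assume "m = 1"
      have "4 \<le> S"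
      proof -
        have "0 \<le> 1 / real s" by simp
        then have "1 \<le> log_term s 0" using log_term_0_ge[OF s] by linarith
        then have "1 \<le> r" by (simp add: r_def a_coef_eq)
        then show ?thesis using rS by linarith
      qed
      moreover have "sqrt 2 \<le> \<tau>"
      proof -
        have "2 * 1 \<le> 2 * (\<alpha> * s)" using \<alpha> s by (intro mult_left_mono mult_ge1_I) auto
        then show ?thesis unfolding \<tau>_def using arg by (intro real_sqrt_le_mono) auto
      qed
      ultimately have "4 * sqrt 2 \<le> S * \<tau>" by (intro mult_mono) auto
      moreover have "0 \<le> sqrt (2::real)" by simp
      ultimately have "2 * sqrt 2 \<le> S * \<tau>" by linarith
      then show False using False \<open>m = 1\<close> by (simp add: Q_def)
    qed
    have x4: "4 < 2 * Q / (r * \<tau>)"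
    proof -
      have "4 * r * \<tau> < S * \<tau>" using rS \<tau> by (intro mult_strict_right_mono) auto
      then have "4 * (r * \<tau>) < S * \<tau>" by (simp only: mult.assoc)
      then have "4 * (r * \<tau>) < 2 * Q" using False by linarith
      then show ?thesis using r \<tau> by (simp only: pos_less_divide_eq mult_pos_pos)
    qed
    \<comment> \<open>The lower bound on \<open>2 ^ K\<close> makes the final bracket cost at most
      \<open>r * \<tau> * Q\<close>, the share of the index -1; the upper bound keeps every
      \<open>t k\<close> in the range of the Bernstein inequality.\<close>
    obtain K where K: "3 \<le> K" "2 * Q / (r * \<tau>) \<le> 2 ^ K" "2 ^ K < 2 * (2 * Q / (r * \<tau>))"
      by (rule ex_pow2_between[OF x4])
    define t where "t k = sqrt (a_coef s k) * \<tau> * Q" for k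
    \<comment> \<open>With \<open>n = 2 ^ (m + 1)\<close>, \<open>4 * n * (b_k / 8)\<close> is
      \<open>b_k * Q\<^sup>2\<close>, so the Bernstein exponent of \<open>t k\<close> is
      \<open>L_k * \<tau>\<^sup>2\<close>.\<close>
    define n :: nat where "n = 2 ^ (m + 1)"
    have n: "0 < n" "real n = 2 * Q\<^sup>2" by (simp_all add: n_def Q(2))
    have t0: "0 \<le> t k" for k unfolding t_def using \<tau> Q(1) a_coef_pos[OF s, of k]
      by (intro mult_nonneg_nonneg) (auto intro: less_imp_le)
    have t2: "(t k)\<^sup>2 = b_coef k * L k * \<tau>\<^sup>2 * Q\<^sup>2" for k
      using a_coef_pos[OF s, of k] by (simp add: t_def power_mult_distrib a_coef_eq L_def)
    \<comment> \<open>After squaring, the claim reduces to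
      \<open>4 * L_k * \<tau>\<^sup>2 \<le> b_k * Q\<^sup>2\<close>, which follows from
      \<open>2 ^ K * r * \<tau> < 4 * Q\<close> and \<open>r\<^sup>2 = 3 * L_0\<close>.\<close>
    have tn: "t k \<le> 2 * real n * (b_coef k / 8)" if k: "k \<le> K" for k
    proof (rule power2_le_imp_le)
      have "2 ^ K * (r * \<tau>) < 4 * Q" using K(3) r \<tau> by (simp add: pos_less_divide_eq)
      then have "(2 ^ K * (r * \<tau>))\<^sup>2 \<le> (4 * Q)\<^sup>2" using r \<tau> by (intro power_mono) auto
      moreover have "r\<^sup>2 = 3 * L 0" using a_coef_pos[OF s, of 0] by (simp add: r_def a_coef_eq L_def)
      moreover have "((2::real) ^ K)\<^sup>2 = 4 ^ K" by (simp add: power2_eq_square flip: power_mult_distrib)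
      ultimately have KQ: "4 ^ K * (3 * L 0) * \<tau>\<^sup>2 \<le> 16 * Q\<^sup>2" by (simp add: power_mult_distrib)
      have "64 * L k * \<tau>\<^sup>2 \<le> 4 ^ K * b_coef k * (3 * L 0) * \<tau>\<^sup>2"
        unfolding L_def using log_term_le_b_coef[OF s K(1) k] by (intro mult_right_mono) auto
      also have "\<dots> = b_coef k * (4 ^ K * (3 * L 0) * \<tau>\<^sup>2)" by simp
      also have "\<dots> \<le> b_coef k * (16 * Q\<^sup>2)" using KQ b_coef_pos[of k] by (intro mult_left_mono) auto
      finally have *: "4 * (L k * \<tau>\<^sup>2) \<le> b_coef k * Q\<^sup>2" by simp
      have "4 * (t k)\<^sup>2 = b_coef k * Q\<^sup>2 * (4 * (L k * \<tau>\<^sup>2))" by (simp add: t2)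
      also have "\<dots> \<le> b_coef k * Q\<^sup>2 * (b_coef k * Q\<^sup>2)" using * b_coef_pos[of k] by (intro mult_left_mono) auto
      also have "\<dots> = 4 * (2 * real n * (b_coef k / 8))\<^sup>2" by (simp add: n power2_eq_square)
      finally show "(t k)\<^sup>2 \<le> (2 * real n * (b_coef k / 8))\<^sup>2" by simp
      show "0 \<le> 2 * real n * (b_coef k / 8)" using b_coef_pos[of k] by simp
    qed
    \<comment> \<open>The \<open>\<alpha>\<close> part of \<open>\<tau>\<^sup>2\<close>, times
      \<open>L_k\<close>, pays for the links; in the \<open>\<beta>\<close> part,
      \<open>178 * L_k \<ge> S\<^sup>2\<close> leaves at least
      \<open>\<beta> * ln m\<close>.\<close>
    have exponent: "exp (- ((t k)\<^sup>2 / (4 * real n * (b_coef k / 8))))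
        \<le> exp (- (2 * \<alpha> * (s * L k))) * real m powr (- \<beta>)" for k
    proof -
      have "(t k)\<^sup>2 / (4 * real n * (b_coef k / 8)) = L k * \<tau>\<^sup>2"
        using b_coef_pos[of k] Q(1) unfolding t2 n(2) by (simp add: field_simps)
      also have "\<dots> = 2 * \<alpha> * (s * L k) + (178 * L k / S\<^sup>2) * (\<beta> * ln m)"
        unfolding \<tau>2 by (simp add: algebra_simps)
      finally have eq: "(t k)\<^sup>2 / (4 * real n * (b_coef k / 8)) = 2 * \<alpha> * (s * L k) + (178 * L k / S\<^sup>2) * (\<beta> * ln m)" .
      have "S\<^sup>2 \<le> 178 * L k" using sqrt_sum_sq_le[OF s] log_term_0_le[of s k] by (simp add: S_def L_def)
      then have "1 \<le> 178 * L k / S\<^sup>2" using S by (simp add: pos_le_divide_eq)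
      then have "1 * (\<beta> * ln m) \<le> (178 * L k / S\<^sup>2) * (\<beta> * ln m)" using \<beta> lnm by (intro mult_right_mono) auto
      then have "2 * \<alpha> * (s * L k) + \<beta> * ln m \<le> (t k)\<^sup>2 / (4 * real n * (b_coef k / 8))" unfolding eq by simp
      then have "exp (- ((t k)\<^sup>2 / (4 * real n * (b_coef k / 8)))) \<le> exp (- (2 * \<alpha> * (s * L k)) + (- \<beta> * ln m))" by simp
      also have "\<dots> = exp (- (2 * \<alpha> * (s * L k))) * real m powr (- \<beta>)"
        using m by (simp only: exp_add) (simp add: powr_def)
      finally show ?thesis .
    qed
    have I: "finite {1..s}" "{1..s} \<noteq> {}" "0 < K" using s K by auto
    obtain P where P:
      "\<And>k. k \<le> K \<Longrightarrow> finite (P k)"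
      "\<And>k. k \<le> K \<Longrightarrow> real (card (P k)) \<le> (exp 1 * (real (k + 1) * 2 ^ (k + 1) + 1)) ^ card {1..s}"
      "\<And>k v w. k \<le> K \<Longrightarrow> (v, w) \<in> P k \<Longrightarrow> v \<in> unit_cube {1..s} \<and> w \<in> unit_cube {1..s} \<and>
          (\<forall>i\<in>{1..s}. v i \<le> w i) \<and> (\<Prod>i\<in>{1..s}. w i) - (\<Prod>i\<in>{1..s}. v i) \<le> 1 / 2 ^ k"
      "\<And>y. y \<in> unit_cube {1..s} \<Longrightarrow> \<exists>p. p 0 = (\<lambda>i\<in>{1..s}. 0) \<and> (\<forall>k\<le>K. (p k, p (Suc k)) \<in> P k) \<and>
          (\<forall>i\<in>{1..s}. p K i \<le> y i \<and> y i \<le> p (Suc K) i)"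
      using that by (rule ex_chain_links[OF I])
    define dev where "dev \<omega> N y = box_deviation s N (\<lambda>n j. X n j \<omega>) y" for \<omega> N y
    define E where "E k q = {\<omega> \<in> space M. \<exists>N\<le>n. t k < \<bar>dev \<omega> N (snd q) - dev \<omega> N (fst q)\<bar>}" for k q
    have Eev: "E k q \<in> events" for k q
    proof -
      have "{\<omega> \<in> space M. t k < \<bar>dev \<omega> N (snd q) - dev \<omega> N (fst q)\<bar>} \<in> events" for N
        unfolding dev_def by measurable
      then have "(\<Union>N\<in>{..n}. {\<omega> \<in> space M. t k < \<bar>dev \<omega> N (snd q) - dev \<omega> N (fst q)\<bar>}) \<in> events"
        by (intro sets.finite_UN) auto
      also have "(\<Union>N\<in>{..n}. {\<omega> \<in> space M. t k < \<bar>dev \<omega> N (snd q) - dev \<omega> N (fst q)\<bar>}) = E k q"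
        by (auto simp: E_def)
      finally show ?thesis .
    qed
    have Ep: "prob (E k q) \<le> 2 * exp (- (2 * \<alpha> * (s * L k))) * real m powr (- \<beta>)"
      if k: "k \<le> K" and q: "q \<in> P k" for k q
    proof -
      have "prob (E k q) \<le> 2 * exp (- ((t k)\<^sup>2 / (4 * real n * (b_coef k / 8))))"
        unfolding E_def dev_def using P(3)[OF k, of "fst q" "snd q"] q s n(1) t0 tn[OF k]
        by (intro prob_link_le) auto
      also have "\<dots> \<le> 2 * (exp (- (2 * \<alpha> * (s * L k))) * real m powr (- \<beta>))"
        using exponent by (intro mult_left_mono) auto
      finally show ?thesis by simp
    qed
    \<comment> \<open>The links depend neither on the sample nor on \<open>N\<close>, so this union
      is finite.\<close>
    define B where "B = (\<Union>k\<in>{..K}. \<Union>q\<in>P k. E k q)"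
    have Pe: "(\<Union>q\<in>P k. E k q) \<in> events" if "k \<le> K" for k
      using P(1)[OF that] Eev by (intro sets.finite_UN) auto
    have Bev: "B \<in> events" unfolding B_def by (intro sets.finite_UN[OF finite_atMost] Pe) simp
    have "prob B \<le> (\<Sum>k\<le>K. prob (\<Union>q\<in>P k. E k q))"
      unfolding B_def using Pe by (intro finite_measure_subadditive_finite) auto
    also have "\<dots> \<le> (\<Sum>k\<le>K. (real (card (P k)) * (2 * exp (- (2 * \<alpha> * (s * log_term s k))))) * real m powr (- \<beta>))"
    proof (rule sum_mono)
      fix k assume "k \<in> {..K}"
      then have k: "k \<le> K" by simp
      have "prob (\<Union>q\<in>P k. E k q) \<le> (\<Sum>q\<in>P k. prob (E k q))"
        using P(1)[OF k] Eev by (intro finite_measure_subadditive_finite) auto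
      also have "\<dots> \<le> (\<Sum>q\<in>P k. 2 * exp (- (2 * \<alpha> * (s * L k))) * real m powr (- \<beta>))"
        using Ep[OF k] by (intro sum_mono) auto
      finally show "prob (\<Union>q\<in>P k. E k q) \<le> (real (card (P k)) * (2 * exp (- (2 * \<alpha> * (s * log_term s k))))) * real m powr (- \<beta>)"
        by (simp add: L_def mult_ac)
    qed
    also have "\<dots> = (\<Sum>k\<le>K. real (card (P k)) * (2 * exp (- (2 * \<alpha> * (s * log_term s k))))) * real m powr (- \<beta>)"
      by (rule sum_distrib_right[symmetric])
    also have "\<dots> \<le> (1 / 2 * real (s + 1) powr (- \<alpha>)) * real m powr (- \<beta>)"
      using P(2) by (intro mult_right_mono chain_prob_sum_le[OF s \<alpha>]) auto
    finally have pB: "prob B \<le> 1 / 2 * real (s + 1) powr (- \<alpha>) * real m powr (- \<beta>)" .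
    have good: "star_discrepancy s N (\<lambda>n j. X n j \<omega>)
        \<le> sqrt (\<alpha> * A_const s + \<beta> * 178 * ln (log 2 N) / s) * sqrt (s / N)"
      if \<omega>: "\<omega> \<in> space M - B" and N: "2 ^ m \<le> N" "N < 2 ^ (m + 1)" for \<omega> N
    proof -
      have Nn: "N \<le> n" using N by (simp add: n_def)
      have NN: "real N \<le> 2 * Q\<^sup>2" using Nn n(2) by simp
      have link: "\<bar>dev \<omega> N w - dev \<omega> N v\<bar> \<le> t k" if "k \<le> K" "(v, w) \<in> P k" for k v w
        using \<omega> that Nn by (force simp: B_def E_def not_less)
      have bound: "\<bar>box_deviation s N (\<lambda>n j. X n j \<omega>) y\<bar> \<le> S * \<tau> * Q" if y: "y \<in> unit_cube {1..s}" for y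
      proof -
        obtain p where p: "p 0 = (\<lambda>i\<in>{1..s}. 0)" "\<And>k. k \<le> K \<Longrightarrow> (p k, p (Suc k)) \<in> P k"
          "\<forall>i\<in>{1..s}. p K i \<le> y i \<and> y i \<le> p (Suc K) i" using P(4)[OF y] by blast
        have "\<bar>box_deviation s N (\<lambda>n j. X n j \<omega>) y\<bar> \<le> (\<Sum>k\<le>K. t k) + N / 2 ^ K"
          using P(3)[OF order_refl p(2)[OF order_refl]] p link[OF _ p(2)]
          unfolding dev_def by (intro abs_box_deviation_chain_le[OF s, of p]) auto
        also have "N / 2 ^ K \<le> r * \<tau> * Q"
        proof -
          have "2 * Q \<le> r * \<tau> * 2 ^ K" using K(2) r \<tau> by (simp add: pos_divide_le_eq mult.commute)
          then have "2 * Q * Q \<le> r * \<tau> * 2 ^ K * Q" using Q by (intro mult_right_mono) auto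
          then have "N \<le> (r * \<tau> * Q) * 2 ^ K" using NN by (simp add: power2_eq_square mult_ac)
          then show ?thesis by (simp add: pos_divide_le_eq)
        qed
        also have "(\<Sum>k\<le>K. t k) + r * \<tau> * Q = (r + (\<Sum>k\<le>K. sqrt (a_coef s k))) * (\<tau> * Q)"
          by (simp add: t_def sum_distrib_right distrib_right mult.assoc)
        also have "\<dots> \<le> S * (\<tau> * Q)"
          using sum_sqrt_a_coef_le_sqrt_sum[OF s, of K] \<tau> Q
          by (intro mult_right_mono) (auto simp: r_def S_def)
        finally show ?thesis by (simp add: mult.assoc)
      qed
      \<comment> \<open>\<open>Q \<le> N / sqrt N\<close> turns the bound
        \<open>S * \<tau> * Q\<close> on deviations into \<open>S * \<tau> / sqrt N\<close> for the
        discrepancy.\<close>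
      have "Q * sqrt N \<le> sqrt N * sqrt N" using NQ[OF N] by (intro mult_right_mono) auto
      then have "Q \<le> N / sqrt N" using NQ(3)[OF N] by (simp add: pos_le_divide_eq)
      then have "S * \<tau> * Q \<le> S * \<tau> * (N / sqrt N)" using S \<tau> by (intro mult_left_mono) auto
      then have "star_discrepancy s N (\<lambda>n j. X n j \<omega>) \<le> S * \<tau> / sqrt N"
        using bound NQ(3)[OF N] by (subst star_discrepancy_le_iff) (auto intro: order_trans)
      then show ?thesis using target[OF N(1)] by linarith
    qed
    show thesis
      by (rule that[OF Bev]) (use pB \<open>m \<noteq> 1\<close> good in auto)
  qed
qed

end

section \<open>Union over all dimensions and dyadic blocks\<close>

theorem theorem4:
  fixes M :: "'a measure" and X :: "nat \<Rightarrow> nat \<Rightarrow> 'a \<Rightarrow> real"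
    and \<alpha> \<beta> :: real
  assumes "prob_space M"
    and "prob_space.indep_vars M (\<lambda>_. borel) (\<lambda>(n, j). X n j) {(n, j). 1 \<le> n \<and> 1 \<le> j}"
    and "\<And>n j. 1 \<le> n \<Longrightarrow> 1 \<le> j \<Longrightarrow>
           distr M borel (X n j) = uniform_measure lborel {0..<1}"
    and "\<alpha> > 1" and "\<beta> > 1"
    and "(zeta_real \<alpha> - 1) * (zeta_real \<beta> - 1) < 1"
  shows "measure M {\<omega> \<in> space M. \<forall>s\<ge>1. \<forall>N\<ge>2.
            star_discrepancy s N (\<lambda>n j. X n j \<omega>)
              \<le> sqrt (\<alpha> * A_const s + \<beta> * 178 * ln (log 2 (real N)) / real s)
                 * sqrt (real s / real N)}
           > 1 - (zeta_real \<alpha> - 1) * (zeta_real \<beta> - 1)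
         \<and> A_const 2 \<le> 942"
proof
  interpret uniform_matrix M X
    by (intro uniform_matrix.intro uniform_matrix_axioms.intro assms(1-3))
  define bnd where "bnd s N = sqrt (\<alpha> * A_const s + \<beta> * 178 * ln (log 2 (real N)) / real s) * sqrt (real s / real N)"
    for s N :: nat
  define za zb where "za = zeta_real \<alpha> - 1" and "zb = zeta_real \<beta> - 1"
  note zs = zeta_real_minus_1[OF assms(4), folded za_def] zeta_real_minus_1[OF assms(5), folded zb_def]
  define good where "good s m E \<longleftrightarrow> E \<in> events \<and>
      prob E \<le> (if m = 1 then 0 else 1 / 2 * real (s + 1) powr (- \<alpha>) * real m powr (- \<beta>)) \<and>
      (\<forall>\<omega>\<in>space M - E. \<forall>N. 2 ^ m \<le> N \<longrightarrow> N < 2 ^ (m + 1) \<longrightarrow>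
         star_discrepancy s N (\<lambda>n j. X n j \<omega>) \<le> bnd s N)" for s m E
  have "\<exists>E. good s m E" if "0 < s" "1 \<le> m" for s m
    using assms(4,5) by (rule_tac star_discrepancy_block[OF that, of \<alpha> \<beta>]) (auto simp: good_def bnd_def)
  then have "\<forall>s m. \<exists>E. 0 < s \<longrightarrow> 1 \<le> m \<longrightarrow> good s m E" by blast
  then obtain E where E: "\<And>s m. 0 < s \<Longrightarrow> 1 \<le> m \<Longrightarrow> good s m (E s m)" by metis
  define F where "F s m = E (Suc s) (Suc m)" for s m
  \<comment> \<open>Index \<open>m\<close> stands for block \<open>m + 1\<close>. The value 0 at
    \<open>m = 0\<close> records that the first block contributes nothing, so that \<open>f\<close>
    sums to \<open>zeta_real \<beta> - 1\<close>.\<close>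
  define f where "f m = (if m = 0 then 0 else real (m + 1) powr (- \<beta>))" for m :: nat
  have F: "F s m \<in> events" "prob (F s m) \<le> (1 / 2 * real (s + 2) powr (- \<alpha>)) * f m" for s m
    using E[of "Suc s" "Suc m"] by (auto simp: good_def F_def f_def add.commute)
  have fs: "f sums zb"
  proof -
    have "(\<lambda>m. f (Suc m)) sums (zb - f 0)" using zs(3) by (simp add: f_def)
    then show ?thesis by (subst (asm) sums_Suc_iff) (simp add: f_def)
  qed
  define G where "G s = (\<Union>m. F s m)" for s
  have Gev: "G s \<in> events" for s unfolding G_def using F by blast
  have pG: "prob (G s) \<le> (1 / 2 * zb) * real (s + 2) powr (- \<alpha>)" for s
  proof -
    define c where "c = 1 / 2 * real (s + 2) powr (- \<alpha>)"
    have cs: "(\<lambda>m. c * f m) sums (c * zb)" by (rule sums_mult[OF fs])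
    have sm: "summable (\<lambda>m. prob (F s m))"
      by (rule summable_comparison_test'[OF sums_summable[OF cs]]) (use F in \<open>auto simp: c_def\<close>)
    have "prob (G s) \<le> (\<Sum>m. prob (F s m))"
      unfolding G_def using F sm by (intro finite_measure_subadditive_countably) auto
    also have "\<dots> \<le> (\<Sum>m. c * f m)"
      using F by (intro suminf_le sm sums_summable[OF cs]) (auto simp: c_def)
    also have "\<dots> = c * zb" using cs by (simp add: sums_iff)
    finally show ?thesis by (simp add: c_def mult_ac)
  qed
  have pbad: "prob (\<Union>s. G s) \<le> 1 / 2 * zb * za"
  proof -
    have cs: "(\<lambda>s. (1 / 2 * zb) * real (s + 2) powr (- \<alpha>)) sums ((1 / 2 * zb) * za)" by (rule sums_mult[OF zs(1)])
    have sm: "summable (\<lambda>s. prob (G s))"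
      by (rule summable_comparison_test'[OF sums_summable[OF cs]]) (use pG in auto)
    have "prob (\<Union>s. G s) \<le> (\<Sum>s. prob (G s))"
      using Gev sm by (intro finite_measure_subadditive_countably) auto
    also have "\<dots> \<le> (\<Sum>s. (1 / 2 * zb) * real (s + 2) powr (- \<alpha>))"
      using pG by (intro suminf_le sm sums_summable[OF cs])
    also have "\<dots> = 1 / 2 * zb * za" using cs by (simp add: sums_iff)
    finally show ?thesis .
  qed
  define A where "A = {\<omega> \<in> space M. \<forall>s\<ge>1. \<forall>N\<ge>2. star_discrepancy s N (\<lambda>n j. X n j \<omega>) \<le> bnd s N}"
  \<comment> \<open>The lower bound passes from a subset to \<open>A\<close> by monotonicity, which
    requires \<open>A\<close> to be measurable.\<close>
  have Aev: "A \<in> events"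
  proof -
    have "{\<omega> \<in> space M. \<forall>s\<in>{1..}. \<forall>N\<in>{2..}. star_discrepancy s N (\<lambda>n j. X n j \<omega>) \<le> bnd s N} \<in> events"
    proof (rule sets.sets_Collect_countable_All')
      fix s :: nat
      show "{\<omega> \<in> space M. \<forall>N\<in>{2..}. star_discrepancy s N (\<lambda>n j. X n j \<omega>) \<le> bnd s N} \<in> events"
        by (rule sets.sets_Collect_countable_All', rule star_discrepancy_event) auto
    qed auto
    then show ?thesis by (simp only: A_def Ball_def atLeast_iff)
  qed
  have "space M - (\<Union>s. G s) \<subseteq> A"
  proof
    fix \<omega> assume \<omega>: "\<omega> \<in> space M - (\<Union>s. G s)"
    have "star_discrepancy s N (\<lambda>n j. X n j \<omega>) \<le> bnd s N" if sN: "1 \<le> s" "2 \<le> N" for s N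
    proof -
      have "\<exists>m. 2 ^ m \<le> N \<and> N < 2 ^ (m + 1)" using sN by (intro ex_power_ivl1) simp_all
      then obtain m where m: "2 ^ m \<le> N" "N < 2 ^ (m + 1)" by (elim exE conjE)
      \<comment> \<open>The exceptional events start with block 1; \<open>N \<ge> 2\<close> excludes
        block 0.\<close>
      have "m \<noteq> 0"
      proof
        assume "m = 0"
        then show False using m(2) sN by simp
      qed
      then have "E s m = F (s - 1) (m - 1)" using sN by (simp add: F_def)
      then have "\<omega> \<notin> E s m" using \<omega> unfolding G_def by blast
      moreover have "good s m (E s m)" using sN \<open>m \<noteq> 0\<close> by (intro E) simp_all
      moreover have "\<omega> \<in> space M" using \<omega> by simp
      ultimately show ?thesis using m unfolding good_def by blast
    qed
    then show "\<omega> \<in> A" using \<omega> by (auto simp: A_def)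
  qed
  then have "prob (space M - (\<Union>s. G s)) \<le> prob A" using Aev by (intro finite_measure_mono)
  moreover have "prob (space M - (\<Union>s. G s)) = 1 - prob (\<Union>s. G s)" using Gev by (intro prob_compl) auto
  \<comment> \<open>The spare factor \<open>1 / 2\<close> makes the final inequality strict, both
    zeta terms being positive.\<close>
  moreover have "1 / 2 * zb * za < za * zb" using zs(2,4) by (simp add: mult.commute)
  ultimately have "1 - za * zb < prob A" using pbad by linarith
  then show "1 - (zeta_real \<alpha> - 1) * (zeta_real \<beta> - 1) < measure M {\<omega> \<in> space M. \<forall>s\<ge>1. \<forall>N\<ge>2.
            star_discrepancy s N (\<lambda>n j. X n j \<omega>)
              \<le> sqrt (\<alpha> * A_const s + \<beta> * 178 * ln (log 2 (real N)) / real s)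
                 * sqrt (real s / real N)}"
    by (simp only: A_def bnd_def za_def zb_def)
  show "A_const 2 \<le> 942" by (rule A_const_2_le)
qed

end
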